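(* For every $p\in(0,1)$ there exists a constant $\alpha(p)\in[0,\log 2]$ such that $$\frac1n\log R_n\to\alpha(p)\quad\text{almost surely as }n\to\infty.$$ Moreover, $$\lim_{n\to\infty}\frac1n\mathbb E[\log R_n]=\lim_{n\to\infty}\frac1n\log\mathbb E[R_n]=\alpha(p).$$
   Context: For $p\in(0,1)$ set $$p_{\mathrm{diamond}}=\frac{p^4}{2p^2-p^4},\qquad p_{\mathrm{series}}=\frac{2p^2-2p^4}{2p^2-p^4}=1-p_{\mathrm{diamond}}.$$ Define random graphs $(G^n)_{n\ge0}$ on one probability space. $G^0$ is a single edge between two vertices $a$ and $b$. Given $G^n$, the graph $G^{n+1}$ is obtained by replacing every edge $\{u,w\}$ of $G^n$, independently of everything else: with probability $p_{\mathrm{diamond}}$ by a diamond, i.e. two internally disjoint paths of length 2 from $u$ to $w$ (a 4-cycle in which $u,w$ are opposite), and with probability $p_{\mathrm{series}}$ by a two-edge series, i.e. a single path of length 2 from $u$ to $w$. The intermediate vertices are new. All edges of $G^n$ have unit resistance, and $R_n$ is the effective resistance between $a$ and $b$ in $G^n$. *)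

theory Defs
  imports "HOL-Probability.Probability"
begin

definition p_diamond :: "real \<Rightarrow> real" where
  "p_diamond p = p ^ 4 / (2 * p\<^sup>2 - p ^ 4)"

definition p_series :: "real \<Rightarrow> real" where
  "p_series p = (2 * p\<^sup>2 - 2 * p ^ 4) / (2 * p\<^sup>2 - p ^ 4)"

lemma p_series_eq:
  assumes "0 < p" "p < 1"
  shows "p_series p = 1 - p_diamond p"
proof -
  have "p\<^sup>2 < 1"
    using assms by (simp add: power_less_one_iff)
  then have "p\<^sup>2 * p\<^sup>2 < p\<^sup>2 * 1"
    using assms by (intro mult_strict_left_mono) auto
  then have "2 * p\<^sup>2 - p ^ 4 > 0"
    using assms by (simp add: power4_eq_xxxx power2_eq_square mult.assoc)
  then show ?thesis
    by (simp add: p_series_def p_diamond_def field_simps)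
qed

text \<open>
  A finite simple graph without isolated vertices is given by a set of ordered pairs, each
  undirected edge \<open>{u, w}\<close> being listed in (at least) one of its two orientations.
  The orientation has no meaning beyond naming the edge.
\<close>

definition verts_of :: "('v \<times> 'v) set \<Rightarrow> 'v set" where
  "verts_of E = fst ` E \<union> snd ` E"

definition neighbours :: "('v \<times> 'v) set \<Rightarrow> 'v \<Rightarrow> 'v set" where
  "neighbours E v = {w. (v, w) \<in> E \<or> (w, v) \<in> E}"

text \<open>
  The potential \<open>\<phi>\<close> drives a unit current from \<open>a\<close> to \<open>b\<close> when all
  edges have unit resistance: by Ohm's law the current from \<open>v\<close> to a neighbour \<open>w\<close> is
  \<open>\<phi> v - \<phi> w\<close>, and by Kirchhoff's node law the net current out of \<open>v\<close> is \<open>1\<close>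
  at \<open>a\<close>, \<open>-1\<close> at \<open>b\<close> and \<open>0\<close> elsewhere.
\<close>

definition unit_current_potential ::
  "('v \<times> 'v) set \<Rightarrow> 'v \<Rightarrow> 'v \<Rightarrow> ('v \<Rightarrow> real) \<Rightarrow> bool" where
  "unit_current_potential E a b \<phi> \<longleftrightarrow>
     (\<forall>v\<in>verts_of E. (\<Sum>w\<in>neighbours E v. \<phi> v - \<phi> w) = of_bool (v = a) - of_bool (v = b))"

text \<open>
  On a finite connected graph such a potential exists and is unique up to an additive constant,
  so the potential difference below is well defined.
\<close>

definition effective_resistance :: "('v \<times> 'v) set \<Rightarrow> 'v \<Rightarrow> 'v \<Rightarrow> real" where
  "effective_resistance E a b =
     (THE r. \<exists>\<phi>. unit_current_potential E a b \<phi> \<and> r = \<phi> a - \<phi> b)"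

datatype motif = Diamond | Series

text \<open>
  \<open>Mid u w i\<close> is an intermediate vertex created when the edge \<open>(u, w)\<close> is replaced.
  Every edge of the \<open>n\<close>-th graph has an endpoint of nesting depth exactly \<open>n\<close>, so the
  vertices \<open>Mid u w i\<close> are indeed new, and distinct for distinct edges.
\<close>

datatype vertex = End_a | End_b | Mid vertex vertex bool

type_synonym edge = "vertex \<times> vertex"

fun replace_edge :: "motif \<Rightarrow> edge \<Rightarrow> edge set" where
  "replace_edge Series (u, w) = {(u, Mid u w False), (Mid u w False, w)}"
| "replace_edge Diamond (u, w) =
     {(u, Mid u w False), (Mid u w False, w), (u, Mid u w True), (Mid u w True, w)}"

text \<open>
  \<open>c n e\<close> is the motif by which the edge \<open>e\<close> is replaced in passing from the
  \<open>n\<close>-th to the next graph; its value is irrelevant if \<open>e\<close> is not an edge of the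
  \<open>n\<close>-th graph.
\<close>

fun hier_graph :: "(nat \<Rightarrow> edge \<Rightarrow> motif) \<Rightarrow> nat \<Rightarrow> edge set" where
  "hier_graph c 0 = {(End_a, End_b)}"
| "hier_graph c (Suc n) = (\<Union>e\<in>hier_graph c n. replace_edge (c n e) e)"

text \<open>
  The choices are made independently for all pairs \<open>(n, e)\<close>, in particular for all edges of
  the \<open>n\<close>-th graph and independently of that graph, which is a function of the choices
  \<open>c m e\<close> with \<open>m < n\<close>.
\<close>

locale diamond_series_process = prob_space M for M :: "'w measure" +
  fixes p :: real and c :: "nat \<Rightarrow> edge \<Rightarrow> 'w \<Rightarrow> motif"
  assumes indep_choices: "indep_vars (\<lambda>_. count_space UNIV) (\<lambda>(n, e). c n e) UNIV"
    and prob_Diamond: "\<And>n e. prob {\<omega> \<in> space M. c n e \<omega> = Diamond} = p_diamond p"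
    and prob_Series: "\<And>n e. prob {\<omega> \<in> space M. c n e \<omega> = Series} = p_series p"

definition resistance :: "(nat \<Rightarrow> edge \<Rightarrow> 'w \<Rightarrow> motif) \<Rightarrow> nat \<Rightarrow> 'w \<Rightarrow> real" where
  "resistance c n \<omega> = effective_resistance (hier_graph (\<lambda>m e. c m e \<omega>) n) End_a End_b"

end

theory Submission
  imports Defs "HOL-Real_Asymp.Real_Asymp"
begin

text \<open>
  Write \<open>q\<close> for the probability of a diamond. Splitting off the first replacement, \<open>R (n + 1)\<close> is
  distributed as \<open>X1 + X2\<close> with probability \<open>1 - q\<close> and as the parallel connection of \<open>X1 + X2\<close> and
  \<open>X3 + X4\<close> with probability \<open>q\<close>, for independent copies \<open>Xi\<close> of \<open>R n\<close>. Since both connections are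
  increasing and concave in each resistance, the recursion preserves the increasing concave order;
  comparing the law of \<open>R n\<close> with the point mass at its mean gives \<open>\<mu> (m + n) \<le> \<mu> m * \<mu> n\<close> for the
  means, so \<open>ln (\<mu> n) / n\<close> converges by Fekete's lemma.

  It remains to see that \<open>R n\<close> is rarely much smaller than \<open>\<mu> n\<close>. The same comparison for conductances
  yields \<open>\<mu> (n + 1) \<ge> 2 / (1 + q) * \<mu> n\<close>, which beats the growth of the second moment, and
  \<open>E (R n)\<^sup>2 \<le> 1.94 (\<mu> n)\<^sup>2\<close> follows uniformly in \<open>q\<close>. As \<open>1.94 < 2\<close>, the Paley-Zygmund inequality
  bounds \<open>P (R n \<le> \<mu> n / 100)\<close> by a constant below \<open>1 / 2\<close>. In either replacement \<open>R (n + 1) \<le> x\<close>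
  forces two independent copies of \<open>R n\<close> to be at most \<open>2 x\<close>, so
  \<open>P (R (n + 1) \<le> x) \<le> 2 P (R n \<le> 2 x)\<^sup>2\<close>; about \<open>sqrt n\<close> iterations of this bound lose only a
  subexponential factor and make the probability summable. Markov's inequality bounds \<open>R n\<close> from above.
\<close>

section \<open>Series-parallel networks\<close>

text \<open>Resistance of two resistors in parallel. Written with inverses it is conjugate to
  addition under \<open>inverse\<close>, and homogeneous, on all reals including 0, so those laws
  carry no side conditions.\<close>

definition harm :: "real \<Rightarrow> real \<Rightarrow> real" where
  "harm x y = inverse (inverse x + inverse y)"

definition net_current :: "('v \<times> 'v) set \<Rightarrow> ('v \<Rightarrow> real) \<Rightarrow> 'v \<Rightarrow> real" where
  "net_current E \<phi> v = (\<Sum>w\<in>neighbours E v. \<phi> v - \<phi> w)"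

lemma finite_neighbours: "finite E \<Longrightarrow> finite (neighbours E v)"
proof -
  assume "finite E"
  moreover have "neighbours E v \<subseteq> fst ` E \<union> snd ` E"
    unfolding neighbours_def by force
  ultimately show ?thesis using finite_subset by blast
qed

lemma neighbours_subset_verts: "neighbours E v \<subseteq> verts_of E"
  unfolding neighbours_def verts_of_def by force

lemma neighbours_verts:
  assumes "x \<in> neighbours E v"
  shows "x \<in> verts_of E" "v \<in> verts_of E"
  using assms unfolding neighbours_def verts_of_def by force+

lemma neighbours_outside: "v \<notin> verts_of E \<Longrightarrow> neighbours E v = {}"
  unfolding neighbours_def verts_of_def by force

lemma net_current_outside: "v \<notin> verts_of E \<Longrightarrow> net_current E \<phi> v = 0"
  by (simp add: net_current_def neighbours_outside)

lemma net_current_cong: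
  assumes "\<And>x. x \<in> verts_of E \<Longrightarrow> \<phi> x = \<psi> x"
  shows "net_current E \<phi> v = net_current E \<psi> v"
proof (cases "v \<in> verts_of E")
  case True
  then show ?thesis
    unfolding net_current_def using assms neighbours_subset_verts[of E v]
    by (intro sum.cong) auto
qed (simp add: net_current_outside)

text \<open>A common neighbour equal to \<open>v\<close> itself is harmless because a loop carries no current.\<close>

lemma net_current_Un:
  assumes "finite E" "finite F" "neighbours E v \<inter> neighbours F v \<subseteq> {v}"
  shows "net_current (E \<union> F) \<phi> v = net_current E \<phi> v + net_current F \<phi> v"
proof -
  have "neighbours (E \<union> F) v = neighbours E v \<union> neighbours F v"
    by (auto simp: neighbours_def)
  moreover have "(\<Sum>w\<in>neighbours E v \<inter> neighbours F v. \<phi> v - \<phi> w) = 0"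
    using assms(3) by (intro sum.neutral) auto
  ultimately show ?thesis
    using assms by (simp add: net_current_def sum_Un finite_neighbours)
qed

lemma verts_of_Un: "verts_of (E \<union> F) = verts_of E \<union> verts_of F"
  by (auto simp: verts_of_def)

text \<open>
  Quantifying over all potentials that are harmonic inside makes the effective resistance unique;
  solvability for all boundary values makes it exist. In this form both properties compose.
\<close>

definition two_terminal :: "('v \<times> 'v) set \<Rightarrow> 'v \<Rightarrow> 'v \<Rightarrow> real \<Rightarrow> bool" where
  "two_terminal E u w R \<longleftrightarrow> finite E \<and> u \<noteq> w \<and> u \<in> verts_of E \<and> w \<in> verts_of E \<and> R > 0 \<and>
     (\<forall>\<phi>. (\<forall>v\<in>verts_of E - {u, w}. net_current E \<phi> v = 0) \<longrightarrow>
        net_current E \<phi> u = (\<phi> u - \<phi> w) / R \<and> net_current E \<phi> w = (\<phi> w - \<phi> u) / R) \<and>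
     (\<forall>x y. \<exists>\<phi>. \<phi> u = x \<and> \<phi> w = y \<and> (\<forall>v\<in>verts_of E - {u, w}. net_current E \<phi> v = 0))"

lemma two_terminalI:
  assumes "finite E" "u \<noteq> w" "u \<in> verts_of E" "w \<in> verts_of E" "R > 0"
    and "\<And>\<phi>. \<forall>v\<in>verts_of E - {u, w}. net_current E \<phi> v = 0 \<Longrightarrow>
      net_current E \<phi> u = (\<phi> u - \<phi> w) / R \<and> net_current E \<phi> w = (\<phi> w - \<phi> u) / R"
    and "\<And>x y. \<exists>\<phi>. \<phi> u = x \<and> \<phi> w = y \<and> (\<forall>v\<in>verts_of E - {u, w}. net_current E \<phi> v = 0)"
  shows "two_terminal E u w R"
  unfolding two_terminal_def by (intro conjI allI impI assms)

lemma two_terminalD: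
  assumes "two_terminal E u w R"
  shows "finite E" "u \<noteq> w" "u \<in> verts_of E" "w \<in> verts_of E" "R > 0"
  using assms unfolding two_terminal_def by blast+

lemma two_terminal_current:
  assumes "two_terminal E u w R" "\<forall>v\<in>verts_of E - {u, w}. net_current E \<phi> v = 0"
  shows "net_current E \<phi> u = (\<phi> u - \<phi> w) / R" "net_current E \<phi> w = (\<phi> w - \<phi> u) / R"
  using assms unfolding two_terminal_def by blast+

lemma two_terminal_potential:
  assumes "two_terminal E u w R"
  obtains \<phi> where "\<phi> u = x" "\<phi> w = y" "\<forall>v\<in>verts_of E - {u, w}. net_current E \<phi> v = 0"
  using assms unfolding two_terminal_def by blast

text \<open>A unit-current potential is harmonic off the terminals, so the current 1 at
  \<open>u\<close> forces the potential difference \<open>R\<close>; solvability supplies such a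
  potential. Hence the description by \<open>THE\<close> denotes \<open>R\<close>.\<close>

lemma effective_resistance_two_terminal:
  assumes tt: "two_terminal E u w R"
  shows "effective_resistance E u w = R"
proof -
  have ne: "u \<noteq> w" and uv: "u \<in> verts_of E" "w \<in> verts_of E" and R: "R > 0"
    using two_terminalD[OF tt] by auto
  have uniq: "\<phi> u - \<phi> w = R" if "unit_current_potential E u w \<phi>" for \<phi>
  proof -
    have cur: "net_current E \<phi> v = of_bool (v = u) - of_bool (v = w)" if "v \<in> verts_of E" for v
      using that \<open>unit_current_potential E u w \<phi>\<close>
      by (auto simp: unit_current_potential_def net_current_def)
    then have "net_current E \<phi> u = (\<phi> u - \<phi> w) / R"
      by (intro two_terminal_current(1)[OF tt]) auto
    with cur[OF uv(1)] ne R show ?thesis by (simp add: field_simps)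
  qed
  \<comment> \<open>Boundary values \<open>R\<close> and \<open>0\<close> make the current at
    \<open>u\<close> equal to 1.\<close>
  obtain \<phi> where \<phi>: "\<phi> u = R" "\<phi> w = 0" "\<forall>v\<in>verts_of E - {u, w}. net_current E \<phi> v = 0"
    using two_terminal_potential[OF tt, of R 0] by metis
  have "unit_current_potential E u w \<phi>"
    unfolding unit_current_potential_def net_current_def[symmetric]
    using two_terminal_current[OF tt \<phi>(3)] \<phi> R ne by auto
  then show ?thesis
    unfolding effective_resistance_def using uniq \<phi> by (intro the_equality) force+
qed

lemma two_terminal_edge:
  assumes "u \<noteq> w"
  shows "two_terminal {(u, w)} u w 1"
proof -
  have *: "neighbours {(u, w)} u = {w}" "neighbours {(u, w)} w = {u}"
    using assms by (auto simp: neighbours_def)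
  have "\<exists>\<phi>. \<phi> u = x \<and> \<phi> w = y" for x y :: real
    using assms by (intro exI[of _ "\<lambda>v. if v = u then x else y"]) auto
  then show ?thesis
    using assms by (auto simp: two_terminal_def verts_of_def net_current_def *)
qed

text \<open>The parts meet only in \<open>m\<close>, so potentials restrict to them and glue from
  them. Kirchhoff's law at \<open>m\<close> fixes \<open>\<phi> m\<close> as a weighted average of
  the terminal values, and the same current then crosses both parts.\<close>

lemma two_terminal_series:
  assumes 1: "two_terminal E u m R" and 2: "two_terminal F m w S"
    and int: "verts_of E \<inter> verts_of F = {m}"
  shows "two_terminal (E \<union> F) u w (R + S)"
proof -
  have fin: "finite E" "finite F" and R: "R > 0" "S > 0"
    and mem: "u \<in> verts_of E" "m \<in> verts_of E" "m \<in> verts_of F" "w \<in> verts_of F"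
    and ne: "u \<noteq> m" "m \<noteq> w"
    using two_terminalD[OF 1] two_terminalD[OF 2] by simp_all
  have only_m: "v = m" if "v \<in> verts_of E" "v \<in> verts_of F" for v
    using that int by auto
  have out: "u \<notin> verts_of F" "w \<notin> verts_of E"
    using only_m mem ne by metis+
  then have uw: "u \<noteq> w" using mem by metis
  have sum: "net_current (E \<union> F) \<phi> v = net_current E \<phi> v + net_current F \<phi> v" for \<phi> v
  proof (rule net_current_Un[OF fin])
    show "neighbours E v \<inter> neighbours F v \<subseteq> {v}"
    proof
      fix x assume "x \<in> neighbours E v \<inter> neighbours F v"
      then have "x \<in> verts_of E \<inter> verts_of F" "v \<in> verts_of E \<inter> verts_of F"
        using neighbours_verts[of x E v] neighbours_verts[of x F v] by simp_all
      then show "x \<in> {v}" unfolding int by simp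
    qed
  qed
  have cur: "net_current (E \<union> F) \<phi> u = (\<phi> u - \<phi> w) / (R + S) \<and>
      net_current (E \<union> F) \<phi> w = (\<phi> w - \<phi> u) / (R + S)"
    if "\<forall>v\<in>verts_of (E \<union> F) - {u, w}. net_current (E \<union> F) \<phi> v = 0" for \<phi>
  proof -
    have z: "net_current E \<phi> v + net_current F \<phi> v = 0"
      if "v \<in> verts_of E \<union> verts_of F" "v \<noteq> u" "v \<noteq> w" for v
      using that \<open>\<forall>v\<in>_. _\<close> by (auto simp: sum verts_of_Un)
    have "net_current E \<phi> v = 0" if v: "v \<in> verts_of E - {u, m}" for v
    proof -
      have "v \<notin> verts_of F" "v \<noteq> w" using v only_m[of v] out by auto
      then show ?thesis using z[of v] v by (simp add: net_current_outside)
    qed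
    then have "\<forall>v\<in>verts_of E - {u, m}. net_current E \<phi> v = 0" by blast
    note c1 = two_terminal_current[OF 1 this]
    have "net_current F \<phi> v = 0" if v: "v \<in> verts_of F - {m, w}" for v
    proof -
      have "v \<notin> verts_of E" "v \<noteq> u" using v only_m[of v] out by auto
      then show ?thesis using z[of v] v by (simp add: net_current_outside)
    qed
    then have "\<forall>v\<in>verts_of F - {m, w}. net_current F \<phi> v = 0" by blast
    note c2 = two_terminal_current[OF 2 this]
    have "(\<phi> m - \<phi> u) / R + (\<phi> m - \<phi> w) / S = 0"
      using z[of m] mem ne c1 c2 by auto
    then have "\<phi> m * (R + S) = \<phi> u * S + \<phi> w * R"
      using R by (simp add: field_simps)
    then have m: "\<phi> m = (\<phi> u * S + \<phi> w * R) / (R + S)"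
      using R by (simp add: field_simps)
    have "net_current (E \<union> F) \<phi> u = (\<phi> u - \<phi> m) / R" "net_current (E \<union> F) \<phi> w = (\<phi> w - \<phi> m) / S"
      using c1 c2 out by (simp_all add: sum net_current_outside)
    moreover have "\<phi> u - \<phi> m = R * ((\<phi> u - \<phi> w) / (R + S))" "\<phi> w - \<phi> m = S * ((\<phi> w - \<phi> u) / (R + S))"
      unfolding m using R by (simp_all add: field_simps)
    ultimately show ?thesis using R by simp
  qed
  have pot: "\<exists>\<phi>. \<phi> u = x \<and> \<phi> w = y \<and> (\<forall>v\<in>verts_of (E \<union> F) - {u, w}. net_current (E \<union> F) \<phi> v = 0)"
    for x y
  proof -
    \<comment> \<open>The value at which the currents from the two parts cancel at
      \<open>m\<close>.\<close>
    define z where "z = (x * S + y * R) / (R + S)"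
    obtain \<phi>1 where P1: "\<phi>1 u = x" "\<phi>1 m = z" "\<forall>v\<in>verts_of E - {u, m}. net_current E \<phi>1 v = 0"
      using two_terminal_potential[OF 1] by metis
    obtain \<phi>2 where P2: "\<phi>2 m = z" "\<phi>2 w = y" "\<forall>v\<in>verts_of F - {m, w}. net_current F \<phi>2 v = 0"
      using two_terminal_potential[OF 2] by metis
    define \<phi> where "\<phi> v = (if v \<in> verts_of E then \<phi>1 v else \<phi>2 v)" for v
    have e1: "net_current E \<phi> v = net_current E \<phi>1 v" for v
      by (rule net_current_cong) (simp add: \<phi>_def)
    have e2: "net_current F \<phi> v = net_current F \<phi>2 v" for v
      by (rule net_current_cong) (use only_m P1(2) P2(1) in \<open>auto simp: \<phi>_def\<close>)
    have "net_current (E \<union> F) \<phi> v = 0" if v: "v \<in> verts_of (E \<union> F) - {u, w}" for v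
    proof (cases "v = m")
      case True
      have "net_current E \<phi>1 m = (z - x) / R" "net_current F \<phi>2 m = (z - y) / S"
        using two_terminal_current[OF 1 P1(3)] two_terminal_current[OF 2 P2(3)] P1 P2 by auto
      moreover have "z - x = R * ((y - x) / (R + S))" "z - y = - S * ((y - x) / (R + S))"
        unfolding z_def using R by (simp_all add: field_simps)
      ultimately show ?thesis using R True by (simp add: sum e1 e2)
    next
      case False
      show ?thesis
      proof (cases "v \<in> verts_of E")
        case True
        then have "v \<notin> verts_of F" using only_m False by metis
        with True P1(3) v False show ?thesis by (simp add: sum e1 e2 net_current_outside)
      next
        case nE: False
        then have "v \<in> verts_of F - {m, w}" using v False by (auto simp: verts_of_Un)
        with nE P2(3) show ?thesis by (simp add: sum e1 e2 net_current_outside)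
      qed
    qed
    moreover have "\<phi> u = x" "\<phi> w = y" using mem out P1 P2 by (auto simp: \<phi>_def)
    ultimately show ?thesis by blast
  qed
  show ?thesis
  proof (rule two_terminalI)
    show "u \<in> verts_of (E \<union> F)" "w \<in> verts_of (E \<union> F)" using mem by (simp_all add: verts_of_Un)
  qed (use fin uw R cur pot in simp_all)
qed

text \<open>The interior conditions decouple and the terminal currents add. As
  \<open>neighbours\<close> is a set, an edge joining \<open>u\<close> and \<open>w\<close> in both
  parts would be counted once in the union; \<open>nadj\<close> excludes this.\<close>

lemma two_terminal_parallel:
  assumes 1: "two_terminal E u w R" and 2: "two_terminal F u w S"
    and int: "verts_of E \<inter> verts_of F = {u, w}"
    and nadj: "w \<notin> neighbours E u"
  shows "two_terminal (E \<union> F) u w (harm R S)"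
proof -
  have fin: "finite E" "finite F" and R: "R > 0" "S > 0"
    and mem: "u \<in> verts_of E" "u \<in> verts_of F" "w \<in> verts_of E" "w \<in> verts_of F"
    and ne: "u \<noteq> w"
    using two_terminalD[OF 1] two_terminalD[OF 2] by simp_all
  have only_uw: "v = u \<or> v = w" if "v \<in> verts_of E" "v \<in> verts_of F" for v
    using that int by auto
  have nadj': "u \<notin> neighbours E w"
    using nadj by (auto simp: neighbours_def)
  have sum: "net_current (E \<union> F) \<phi> v = net_current E \<phi> v + net_current F \<phi> v" for \<phi> v
  proof (rule net_current_Un[OF fin])
    show "neighbours E v \<inter> neighbours F v \<subseteq> {v}"
    proof
      fix x assume x: "x \<in> neighbours E v \<inter> neighbours F v"
      then have "x \<in> verts_of E \<inter> verts_of F" "v \<in> verts_of E \<inter> verts_of F"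
        using neighbours_verts[of x E v] neighbours_verts[of x F v] by simp_all
      then have "x = u \<or> x = w" "v = u \<or> v = w" unfolding int by simp_all
      with x nadj nadj' show "x \<in> {v}" by blast
    qed
  qed
  have zE: "net_current (E \<union> F) \<phi> v = net_current E \<phi> v" if "v \<in> verts_of E - {u, w}" for v \<phi>
    using that int by (subst sum, subst (2) net_current_outside) auto
  have zF: "net_current (E \<union> F) \<phi> v = net_current F \<phi> v" if "v \<in> verts_of F - {u, w}" for v \<phi>
    using that int by (subst sum, subst net_current_outside) auto
  have h: "x / R + x / S = x / harm R S" for x
    by (simp add: harm_def divide_inverse ring_distribs)
  have cur: "net_current (E \<union> F) \<phi> u = (\<phi> u - \<phi> w) / harm R S \<and>
      net_current (E \<union> F) \<phi> w = (\<phi> w - \<phi> u) / harm R S"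
    if "\<forall>v\<in>verts_of (E \<union> F) - {u, w}. net_current (E \<union> F) \<phi> v = 0" for \<phi>
  proof -
    have "\<forall>v\<in>verts_of E - {u, w}. net_current E \<phi> v = 0"
      using that zE[where \<phi> = \<phi>] by (metis Diff_iff UnI1 verts_of_Un)
    note c1 = two_terminal_current[OF 1 this]
    have "\<forall>v\<in>verts_of F - {u, w}. net_current F \<phi> v = 0"
      using that zF[where \<phi> = \<phi>] by (metis Diff_iff UnI2 verts_of_Un)
    note c2 = two_terminal_current[OF 2 this]
    show ?thesis by (simp add: sum c1 c2 h)
  qed
  have pot: "\<exists>\<phi>. \<phi> u = x \<and> \<phi> w = y \<and> (\<forall>v\<in>verts_of (E \<union> F) - {u, w}. net_current (E \<union> F) \<phi> v = 0)"
    for x y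
  proof -
    obtain \<phi>1 where P1: "\<phi>1 u = x" "\<phi>1 w = y" "\<forall>v\<in>verts_of E - {u, w}. net_current E \<phi>1 v = 0"
      using two_terminal_potential[OF 1] by metis
    obtain \<phi>2 where P2: "\<phi>2 u = x" "\<phi>2 w = y" "\<forall>v\<in>verts_of F - {u, w}. net_current F \<phi>2 v = 0"
      using two_terminal_potential[OF 2] by metis
    define \<phi> where "\<phi> v = (if v \<in> verts_of E then \<phi>1 v else \<phi>2 v)" for v
    have e1: "net_current E \<phi> v = net_current E \<phi>1 v" for v
      by (rule net_current_cong) (simp add: \<phi>_def)
    have e2: "net_current F \<phi> v = net_current F \<phi>2 v" for v
      by (rule net_current_cong) (use only_uw P1(1,2) P2(1,2) in \<open>unfold \<phi>_def, metis\<close>)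
    have "net_current (E \<union> F) \<phi> v = 0" if v: "v \<in> verts_of (E \<union> F) - {u, w}" for v
      using v zE[of v \<phi>] zF[of v \<phi>] P1(3) P2(3) by (auto simp: verts_of_Un e1 e2)
    moreover have "\<phi> u = x" "\<phi> w = y" using mem P1 by (auto simp: \<phi>_def)
    ultimately show ?thesis by blast
  qed
  have "harm R S > 0" using R by (simp add: harm_def add_pos_pos)
  then show ?thesis
  proof (intro two_terminalI)
    show "u \<in> verts_of (E \<union> F)" "w \<in> verts_of (E \<union> F)" using mem by (simp_all add: verts_of_Un)
  qed (use fin ne cur pot in simp_all)
qed

section \<open>The resistance of the hierarchical graph\<close>

text \<open>Resistance of the network that grows out of edge \<open>e\<close> of generation
  \<open>k\<close> in \<open>n\<close> replacements, computed by the series and parallel laws. The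
  choices are indexed by pairs, the index set over which they are independent.\<close>

fun res :: "(nat \<times> edge \<Rightarrow> motif) \<Rightarrow> nat \<Rightarrow> nat \<Rightarrow> edge \<Rightarrow> real" where
  "res f 0 k e = 1"
| "res f (Suc n) k (u, w) =
     (let path = (\<lambda>i. res f n (Suc k) (u, Mid u w i) + res f n (Suc k) (Mid u w i, w))
      in case f (k, (u, w)) of Series \<Rightarrow> path False | Diamond \<Rightarrow> harm (path False) (path True))"

text \<open>
  Unlike \<^const>\<open>hier_graph\<close>, this recursion performs the first replacement first, at level \<open>k\<close>.
\<close>

fun subgraph :: "(nat \<times> edge \<Rightarrow> motif) \<Rightarrow> nat \<Rightarrow> nat \<Rightarrow> edge \<Rightarrow> edge set" where
  "subgraph f 0 k e = {e}"
| "subgraph f (Suc n) k e = (\<Union>e'\<in>replace_edge (f (k, e)) e. subgraph f n (Suc k) e')"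

text \<open>Unfolding the replacement tree from the root or extending it at the leaves gives the
  same edges; this links \<open>subgraph\<close> to \<open>hier_graph\<close>.\<close>

lemma subgraph_Suc_last:
  "subgraph f (Suc n) k e = (\<Union>e'\<in>subgraph f n k e. replace_edge (f (k + n, e')) e')"
proof (induction n arbitrary: k e)
  case (Suc n)
  have "subgraph f (Suc (Suc n)) k e = (\<Union>e'\<in>replace_edge (f (k, e)) e. subgraph f (Suc n) (Suc k) e')"
    by simp
  also have "\<dots> = (\<Union>e'\<in>replace_edge (f (k, e)) e. \<Union>e''\<in>subgraph f n (Suc k) e'. replace_edge (f (Suc k + n, e'')) e'')"
    by (subst Suc) simp
  finally show ?case by simp
qed auto

lemma hier_graph_eq_subgraph:
  "hier_graph c n = subgraph (\<lambda>(m, e). c m e) n 0 (End_a, End_b)"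
proof (induction n)
  case (Suc n)
  then show ?case by (subst subgraph_Suc_last) simp
qed simp

text \<open>
  The edge whose replacement created a given edge can be read off from its endpoint of larger size.
  Since this works for arbitrary edges, different subnetworks share no vertices besides terminals.
\<close>

definition parent :: "edge \<Rightarrow> edge" where
  "parent e = (case (if size (fst e) < size (snd e) then snd e else fst e) of
     Mid s t _ \<Rightarrow> (s, t) | _ \<Rightarrow> e)"

text \<open>Replacement strictly increases this size and \<open>parent\<close> never does, which
  separates an edge from its descendants.\<close>

definition edge_size :: "edge \<Rightarrow> nat" where
  "edge_size e = max (size (fst e)) (size (snd e))"

lemma parent_sub [simp]: "parent (u, Mid u w i) = (u, w)" "parent (Mid u w i, w) = (u, w)"
  by (simp_all add: parent_def)

lemma edge_size_parent: "edge_size (parent e) \<le> edge_size e"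
  by (cases e) (auto simp: parent_def edge_size_def split: vertex.split)

lemma edge_size_ancestor: "edge_size ((parent ^^ j) e) \<le> edge_size e"
  by (induction j) (auto intro: order_trans edge_size_parent)

lemma edge_size_sub:
  "edge_size (u, w) < edge_size (u, Mid u w i)" "edge_size (u, w) < edge_size (Mid u w i, w)"
  by (auto simp: edge_size_def)

text \<open>An outer bound for the interior of the network grown from \<open>e\<close> that does not
  depend on the choices or on the number of replacements: all mid vertices whose creating edge has
  \<open>e\<close> among its ancestors.\<close>

definition inner :: "edge \<Rightarrow> vertex set" where
  "inner e = {Mid x y i |x y i. \<exists>j. (parent ^^ j) (x, y) = e}"

lemma size_inner:
  assumes "v \<in> inner e"
  shows "edge_size e < size v"
proof -
  obtain x y i j where v: "v = Mid x y i" "(parent ^^ j) (x, y) = e"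
    using assms by (auto simp: inner_def)
  then have "edge_size e \<le> edge_size (x, y)" using edge_size_ancestor by blast
  also have "\<dots> < size v" using v by (simp add: edge_size_def)
  finally show ?thesis .
qed

lemma inner_parent_subset:
  assumes "parent e' = e"
  shows "inner e' \<subseteq> inner e"
proof
  fix v assume "v \<in> inner e'"
  then obtain x y i j where v: "v = Mid x y i" "(parent ^^ j) (x, y) = e'"
    by (auto simp: inner_def)
  then have "(parent ^^ Suc j) (x, y) = e" using assms by simp
  with v show "v \<in> inner e" unfolding inner_def by blast
qed

text \<open>A common vertex names one edge having both \<open>e1\<close> and \<open>e2\<close> as
  ancestors. Ancestors form a chain, so one of the two is reached from the other through the parent
  \<open>e\<close>, which is too small to have it as an ancestor.\<close>

lemma inner_disjoint:
  assumes "parent e1 = e" "parent e2 = e" "edge_size e < edge_size e1" "edge_size e < edge_size e2"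
    and "e1 \<noteq> e2"
  shows "inner e1 \<inter> inner e2 = {}"
proof -
  have *: False if "parent e1 = e" "edge_size e < edge_size e2" "e1 \<noteq> e2"
    "(parent ^^ j) f = e1" "(parent ^^ j') f = e2" "j \<le> j'" for e1 e2 j j' f
  proof (cases "j = j'")
    case False
    then obtain d where d: "j' = Suc d + j"
      using \<open>j \<le> j'\<close> by (metis add.commute le_neq_implies_less less_iff_Suc_add add_Suc_right add_Suc)
    have "e2 = (parent ^^ Suc d) ((parent ^^ j) f)"
      using that(5) unfolding d funpow_add by simp
    also have "\<dots> = (parent ^^ d) e"
      using that by (simp add: funpow_swap1)
    finally have "edge_size e2 \<le> edge_size e" using edge_size_ancestor by simp
    with that show False by simp
  qed (use that in auto)
  show ?thesis
  proof (intro equals0I)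
    fix v assume "v \<in> inner e1 \<inter> inner e2"
    then obtain f j j' where "(parent ^^ j) f = e1" "(parent ^^ j') f = e2"
      by (auto simp: inner_def)
    with *[of e1 e2 j f j'] *[of e2 e1 j' f j] assms show False by (metis nat_le_linear)
  qed
qed

lemma Mid_in_inner: "Mid u w i \<in> inner (u, w)"
  unfolding inner_def by (auto intro: exI[of _ 0])

lemma verts_of_subgraph: "verts_of (subgraph f n k (u, w)) \<subseteq> {u, w} \<union> inner (u, w)"
proof (induction n arbitrary: k u w)
  case (Suc n)
  have sub: "verts_of (subgraph f n (Suc k) (u, Mid u w i)) \<subseteq> {u, w} \<union> inner (u, w)"
    "verts_of (subgraph f n (Suc k) (Mid u w i, w)) \<subseteq> {u, w} \<union> inner (u, w)" for i
    using Suc[of "Suc k" u "Mid u w i"] Suc[of "Suc k" "Mid u w i" w] Mid_in_inner[of u w i]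
      inner_parent_subset[of "(u, Mid u w i)"] inner_parent_subset[of "(Mid u w i, w)"]
    by (auto simp: subset_iff)
  show ?case
    by (cases "f (k, (u, w))") (simp_all add: verts_of_Un sub del: Un_insert_left)
qed (auto simp: verts_of_def)

text \<open>Splitting off the first replacement leaves two or four independent subnetworks. The work
  lies in showing that they share only the expected terminals, so that the series and parallel laws
  apply.\<close>

lemma two_terminal_subgraph:
  assumes "u \<noteq> w"
  shows "two_terminal (subgraph f n k (u, w)) u w (res f n k (u, w))"
  using assms
proof (induction n arbitrary: k u w)
  case (Suc n)
  define L where "L i = subgraph f n (Suc k) (u, Mid u w i)" for i
  define R where "R i = subgraph f n (Suc k) (Mid u w i, w)" for i
  define a where "a i = res f n (Suc k) (u, Mid u w i)" for i
  define b where "b i = res f n (Suc k) (Mid u w i, w)" for i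
  have ne: "u \<noteq> Mid u w i" "Mid u w i \<noteq> w" "w \<noteq> Mid u w i" for i
    by (metis less_irrefl size_inner Mid_in_inner edge_size_def fst_conv snd_conv max_less_iff_conj)+
  have tL: "two_terminal (L i) u (Mid u w i) (a i)" and tR: "two_terminal (R i) (Mid u w i) w (b i)" for i
    unfolding L_def R_def a_def b_def using ne by (auto intro: Suc.IH)
  have mem: "u \<in> verts_of (L i)" "Mid u w i \<in> verts_of (L i)" "Mid u w i \<in> verts_of (R i)" "w \<in> verts_of (R i)" for i
    using two_terminalD[OF tL[of i]] two_terminalD[OF tR[of i]] by auto
  have vL: "verts_of (L i) \<subseteq> {u, Mid u w i} \<union> inner (u, Mid u w i)" for i
    unfolding L_def by (rule verts_of_subgraph)
  have vR: "verts_of (R i) \<subseteq> {Mid u w i, w} \<union> inner (Mid u w i, w)" for i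
    unfolding R_def by (rule verts_of_subgraph)
  \<comment> \<open>These vertices are no larger than the sub-edges, whereas inner vertices are
    strictly larger.\<close>
  have big: "v \<notin> inner (u, Mid u w j)" "v \<notin> inner (Mid u w j, w)" if "v \<in> {u, w, Mid u w i}" for v i j
    using that size_inner[of v "(u, Mid u w j)"] size_inner[of v "(Mid u w j, w)"]
    by (auto simp: edge_size_def)
  have d: "\<not> (v \<in> A \<and> v \<in> B)" if "A \<inter> B = {}" for A B and v :: vertex
    using that by auto
  have dLR: "inner (u, Mid u w i) \<inter> inner (Mid u w j, w) = {}" for i j
    using ne by (intro inner_disjoint[of _ "(u, w)"]) (auto simp: edge_size_sub)
  have dLL: "inner (u, Mid u w i) \<inter> inner (u, Mid u w j) = {}" if "i \<noteq> j" for i j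
    using that by (intro inner_disjoint[of _ "(u, w)"]) (auto simp: edge_size_sub)
  have dRR: "inner (Mid u w i, w) \<inter> inner (Mid u w j, w) = {}" if "i \<noteq> j" for i j
    using that by (intro inner_disjoint[of _ "(u, w)"]) (auto simp: edge_size_sub)
  have iLR: "verts_of (L i) \<inter> verts_of (R i) = {Mid u w i}" for i
  proof (intro equalityI subsetI)
    fix v assume "v \<in> verts_of (L i) \<inter> verts_of (R i)"
    then have "v = u \<or> v = Mid u w i \<or> v \<in> inner (u, Mid u w i)"
      "v = w \<or> v = Mid u w i \<or> v \<in> inner (Mid u w i, w)"
      using vL[of i] vR[of i] by auto
    then show "v \<in> {Mid u w i}"
      using big[of v i i] d[OF dLR[of i i], of v] Suc.prems by blast
  qed (use mem in auto)
  have path: "two_terminal (L i \<union> R i) u w (a i + b i)" for i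
    by (rule two_terminal_series[OF tL tR iLR])
  have iP: "verts_of (L False \<union> R False) \<inter> verts_of (L True \<union> R True) = {u, w}" (is "?A \<inter> ?B = _")
  proof
    show "{u, w} \<subseteq> ?A \<inter> ?B" using mem by (auto simp: verts_of_Un)
    show "?A \<inter> ?B \<subseteq> {u, w}"
    proof
      fix v assume v: "v \<in> ?A \<inter> ?B"
      have A: "v = u \<or> v = w \<or> v = Mid u w False \<or> v \<in> inner (u, Mid u w False) \<or> v \<in> inner (Mid u w False, w)"
        using v vL[of False] vR[of False] by (auto simp: verts_of_Un)
      have B: "v = u \<or> v = w \<or> v = Mid u w True \<or> v \<in> inner (u, Mid u w True) \<or> v \<in> inner (Mid u w True, w)"
        using v vL[of True] vR[of True] by (auto simp: verts_of_Un)
      have "\<not> (v \<in> inner (u, Mid u w False) \<or> v \<in> inner (Mid u w False, w)) \<or>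
        \<not> (v \<in> inner (u, Mid u w True) \<or> v \<in> inner (Mid u w True, w))"
        using d[OF dLL[of False True], of v] d[OF dRR[of False True], of v]
          d[OF dLR[of False True], of v] d[OF dLR[of True False], of v] by blast
      moreover have "Mid u w False \<noteq> Mid u w True" by simp
      ultimately show "v \<in> {u, w}"
        using A B big[of v False True] big[of v True False] by blast
    qed
  qed
  \<comment> \<open>The two halves of a path meet only in its middle vertex, so \<open>u\<close> and
    \<open>w\<close> are not adjacent.\<close>
  have "u \<notin> verts_of (R False)" "w \<notin> verts_of (L False)"
    using mem[of False] ne[of False] IntI[of _ "verts_of (L False)" "verts_of (R False)"]
    unfolding iLR[of False] by blast+
  then have nadj: "w \<notin> neighbours (L False \<union> R False) u"
    using neighbours_outside[of u "R False"] neighbours_subset_verts[of "L False" u]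
    by (auto simp: neighbours_def)
  show ?case
  proof (cases "f (k, (u, w))")
    case Diamond
    have "subgraph f (Suc n) k (u, w) = (L False \<union> R False) \<union> (L True \<union> R True)"
      using Diamond by (auto simp: L_def R_def)
    then show ?thesis
      using two_terminal_parallel[OF path path iP nadj] Diamond by (simp add: a_def b_def)
  next
    case Series
    then show ?thesis using path[of False] by (simp add: L_def R_def a_def b_def)
  qed
qed (simp add: two_terminal_edge)

lemma resistance_eq_res:
  "resistance c n \<omega> = res (\<lambda>(m, e). c m e \<omega>) n 0 (End_a, End_b)"
  unfolding resistance_def hier_graph_eq_subgraph
  by (intro effective_resistance_two_terminal two_terminal_subgraph) simp

section \<open>The law of the resistance\<close>

definition combine :: "(real \<Rightarrow> real \<Rightarrow> real) \<Rightarrow> real pmf \<Rightarrow> real pmf \<Rightarrow> real pmf" where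
  "combine op \<mu> \<nu> = map_pmf (\<lambda>(x, y). op x y) (pair_pmf \<mu> \<nu>)"

text \<open>
  \<open>s\<close> and \<open>d\<close> are the series and parallel operations; exchanging them describes conductances.
\<close>

definition step_law ::
  "real \<Rightarrow> (real \<Rightarrow> real \<Rightarrow> real) \<Rightarrow> (real \<Rightarrow> real \<Rightarrow> real) \<Rightarrow> real pmf \<Rightarrow> real pmf" where
  "step_law q s d \<nu> = bind_pmf (bernoulli_pmf q)
     (\<lambda>b. if b then combine d (combine s \<nu> \<nu>) (combine s \<nu> \<nu>) else combine s \<nu> \<nu>)"

definition law :: "real \<Rightarrow> nat \<Rightarrow> real pmf" where
  "law q n = (step_law q (+) harm ^^ n) (return_pmf 1)"

text \<open>Functions of disjoint blocks of independent coordinates are independent; the last two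
  assumptions say which block each function reads.\<close>

lemma map_Pi_pmf_pair:
  assumes fin: "finite A" "finite B" and disj: "A \<inter> B = {}"
    and F: "\<And>f g. (\<And>x. x \<in> A \<Longrightarrow> f x = g x) \<Longrightarrow> F f = F g"
    and G: "\<And>f g. (\<And>x. x \<in> B \<Longrightarrow> f x = g x) \<Longrightarrow> G f = G g"
  shows "map_pmf (\<lambda>f. (F f, G f)) (Pi_pmf (A \<union> B) dflt P) =
    pair_pmf (map_pmf F (Pi_pmf A dflt P)) (map_pmf G (Pi_pmf B dflt P))"
proof -
  have "(F (\<lambda>x. if x \<in> A then f x else g x), G (\<lambda>x. if x \<in> A then f x else g x)) = (F f, G g)" for f g
    using disj by (intro arg_cong2[of _ _ _ _ Pair] F G) auto
  then show ?thesis
    unfolding Pi_pmf_union[OF fin disj] map_pmf_comp pair_map_pmf1 pair_map_pmf2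
    by (intro map_pmf_cong refl) (auto simp: case_prod_unfold)
qed

lemma map_Pi_pmf_combine:
  assumes "finite A" "finite B" "A \<inter> B = {}"
    and "\<And>f g. (\<And>x. x \<in> A \<Longrightarrow> f x = g x) \<Longrightarrow> F f = F g"
    and "\<And>f g. (\<And>x. x \<in> B \<Longrightarrow> f x = g x) \<Longrightarrow> G f = G g"
  shows "map_pmf (\<lambda>f. op (F f) (G f)) (Pi_pmf (A \<union> B) dflt P) =
    combine op (map_pmf F (Pi_pmf A dflt P)) (map_pmf G (Pi_pmf B dflt P))"
proof -
  have "map_pmf (\<lambda>f. (F f, G f)) (Pi_pmf (A \<union> B) dflt P) =
      pair_pmf (map_pmf F (Pi_pmf A dflt P)) (map_pmf G (Pi_pmf B dflt P))"
    by (intro map_Pi_pmf_pair assms)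
  from arg_cong[OF this, where f = "map_pmf (\<lambda>(x, y). op x y)"] show ?thesis
    by (simp add: combine_def map_pmf_comp)
qed

text \<open>Every replacement is taken to be a diamond, so this is a deterministic finite set
  containing all choices that \<open>res\<close> could read, whatever their outcomes.\<close>

fun choices :: "nat \<Rightarrow> nat \<Rightarrow> edge \<Rightarrow> (nat \<times> edge) set" where
  "choices 0 k e = {}"
| "choices (Suc n) k e =
     insert (k, e) (\<Union>e'\<in>replace_edge Diamond e. choices n (Suc k) e')"

lemma finite_choices: "finite (choices n k e)"
proof (induction n arbitrary: k e)
  case (Suc n)
  then show ?case by (cases e) simp
qed simp

lemma choices_ancestor:
  "(j, e') \<in> choices n k e \<Longrightarrow> k \<le> j \<and> (parent ^^ (j - k)) e' = e"
proof (induction n arbitrary: k e)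
  case (Suc n)
  show ?case
  proof (cases "(j, e') = (k, e)")
    case False
    then obtain e'' where e'': "e'' \<in> replace_edge Diamond e" "(j, e') \<in> choices n (Suc k) e''"
      using Suc.prems by auto
    have IH: "Suc k \<le> j" "(parent ^^ (j - Suc k)) e' = e''" using Suc.IH[OF e''(2)] by auto
    have "parent e'' = e" using e''(1) by (cases e) auto
    then have "(parent ^^ Suc (j - Suc k)) e' = e" using IH by simp
    moreover have "Suc (j - Suc k) = j - k" using IH by simp
    ultimately show ?thesis using IH by simp
  qed auto
qed simp

text \<open>An index records its generation, and going back to generation \<open>k\<close> through
  \<open>parent\<close> recovers the edge. Distinct edges of one generation therefore read disjoint,
  hence independent, choices.\<close>

lemma choices_disjoint:
  assumes "e1 \<noteq> e2"
  shows "choices n k e1 \<inter> choices n k e2 = {}"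
  using choices_ancestor[of _ _ n k] assms by (auto, blast)

lemma res_cong:
  assumes "\<And>i. i \<in> choices n k e \<Longrightarrow> f i = g i"
  shows "res f n k e = res g n k e"
  using assms
proof (induction n arbitrary: k e)
  case (Suc n)
  obtain u w where e: "e = (u, w)" by (cases e)
  have "res f n (Suc k) e' = res g n (Suc k) e'" if "e' \<in> replace_edge Diamond e" for e'
    using that by (intro Suc.IH Suc.prems) auto
  moreover have "f (k, e) = g (k, e)" by (intro Suc.prems) simp
  ultimately show ?case by (simp add: e)
qed simp

definition motif_pmf :: "real \<Rightarrow> motif pmf" where
  "motif_pmf q = map_pmf (\<lambda>b. if b then Diamond else Series) (bernoulli_pmf q)"

text \<open>The first choice, the two paths and the two halves of each path read disjoint blocks of
  choices, so the recursion of \<open>res\<close> turns into \<open>step_law\<close>. Both paths are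
  sampled even when the first replacement is a series.\<close>

lemma map_res_Pi_pmf:
  "u \<noteq> w \<Longrightarrow> map_pmf (\<lambda>f. res f n k (u, w)) (Pi_pmf (choices n k (u, w)) Series (\<lambda>_. motif_pmf q)) = law q n"
proof (induction n arbitrary: k u w)
  case 0
  then show ?case by (simp add: law_def)
next
  case (Suc n)
  let ?P = "\<lambda>A. Pi_pmf A Series (\<lambda>_. motif_pmf q)"
  define l where "l i = (u, Mid u w i)" for i
  define r where "r i = (Mid u w i, w)" for i
  define C where "C e = choices n (Suc k) e" for e
  define F where "F e f = res f n (Suc k) e" for e f
  define path where "path i f = F (l i) f + F (r i) f" for i f
  define P where "P i = C (l i) \<union> C (r i)" for i
  have ne: "u \<noteq> Mid u w i" "Mid u w i \<noteq> w" for i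
    using edge_size_sub[of u w i] by (auto simp: edge_size_def)
  have lr: "l i \<noteq> r j" for i j
    using ne Suc.prems by (auto simp: l_def r_def)
  have finC: "finite (C e)" for e by (simp add: C_def finite_choices)
  have F: "F e f = F e g" if "\<And>x. x \<in> C e \<Longrightarrow> f x = g x" for e f g
    using that unfolding F_def C_def by (rule res_cong)
  have lawF: "map_pmf (F (l i)) (?P (C (l i))) = law q n" "map_pmf (F (r i)) (?P (C (r i))) = law q n" for i
    unfolding F_def C_def l_def r_def by (intro Suc.IH ne)+
  have finP: "finite (P i)" for i by (simp add: P_def finC)
  have path: "path i f = path i g" if "\<And>x. x \<in> P i \<Longrightarrow> f x = g x" for i f g
    unfolding path_def using that F[of "l i" f g] F[of "r i" f g] by (simp add: P_def)
  have lawpath: "map_pmf (path i) (?P (P i)) = combine (+) (law q n) (law q n)" for i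
  proof -
    have "C (l i) \<inter> C (r i) = {}"
      unfolding C_def by (rule choices_disjoint[OF lr])
    then have "map_pmf (\<lambda>f. F (l i) f + F (r i) f) (?P (C (l i) \<union> C (r i))) =
        combine (+) (map_pmf (F (l i)) (?P (C (l i)))) (map_pmf (F (r i)) (?P (C (r i))))"
      by (intro map_Pi_pmf_combine finC F)
    then show ?thesis by (simp add: path_def[abs_def] P_def lawF)
  qed
  have disjP: "P False \<inter> P True = {}"
    unfolding P_def C_def using lr choices_disjoint[of _ _ n "Suc k"]
    by (auto simp: Int_Un_distrib Int_Un_distrib2 l_def r_def)
  define B where "B = P False \<union> P True"
  have choices: "choices (Suc n) k (u, w) = {(k, (u, w))} \<union> B"
    by (auto simp: B_def P_def C_def l_def r_def)
  have finB: "finite B" by (simp add: B_def finP)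
  have "(k, (u, w)) \<notin> C e" for e
    unfolding C_def using choices_ancestor by fastforce
  then have top: "{(k, (u, w))} \<inter> B = {}" by (simp add: B_def P_def)
  let ?H = "\<lambda>m (a, b). case m of Series \<Rightarrow> a | Diamond \<Rightarrow> harm a b"
  let ?G = "\<lambda>f. (path False f, path True f)"
  have G: "?G f = ?G g" if "\<And>x. x \<in> B \<Longrightarrow> f x = g x" for f g
    using that path[of False f g] path[of True f g] by (simp add: B_def)
  have lawG: "map_pmf ?G (?P B) = pair_pmf (combine (+) (law q n) (law q n)) (combine (+) (law q n) (law q n))"
  proof -
    have "map_pmf ?G (?P (P False \<union> P True)) =
        pair_pmf (map_pmf (path False) (?P (P False))) (map_pmf (path True) (?P (P True)))"
      by (intro map_Pi_pmf_pair finP disjP path)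
    then show ?thesis by (simp add: B_def lawpath)
  qed
  have "map_pmf (\<lambda>f. res f (Suc n) k (u, w)) (?P ({(k, (u, w))} \<union> B)) =
      map_pmf (\<lambda>(m, ab). ?H m ab) (map_pmf (\<lambda>f. (f (k, (u, w)), ?G f)) (?P ({(k, (u, w))} \<union> B)))"
    unfolding map_pmf_comp by (intro map_pmf_cong refl) (simp add: path_def F_def l_def r_def Let_def)
  also have "map_pmf (\<lambda>f. (f (k, (u, w)), ?G f)) (?P ({(k, (u, w))} \<union> B)) =
      pair_pmf (map_pmf (\<lambda>f. f (k, (u, w))) (?P {(k, (u, w))})) (map_pmf ?G (?P B))"
    by (intro map_Pi_pmf_pair finB top G) simp_all
  also have "map_pmf (\<lambda>f. f (k, (u, w))) (?P {(k, (u, w))}) = motif_pmf q"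
    by (simp add: Pi_pmf_singleton map_pmf_comp)
  also have "map_pmf (\<lambda>(m, ab). ?H m ab) (pair_pmf (motif_pmf q) (map_pmf ?G (?P B))) =
      bind_pmf (bernoulli_pmf q) (\<lambda>b. map_pmf (?H (if b then Diamond else Series)) (map_pmf ?G (?P B)))"
    by (simp add: motif_pmf_def pair_pmf_def map_pmf_def bind_assoc_pmf bind_return_pmf)
  also have "\<dots> = step_law q (+) harm (law q n)"
    unfolding step_law_def
  proof (intro bind_pmf_cong refl)
    fix b :: bool
    show "map_pmf (?H (if b then Diamond else Series)) (map_pmf ?G (?P B)) =
      (if b then combine harm (combine (+) (law q n) (law q n)) (combine (+) (law q n) (law q n))
       else combine (+) (law q n) (law q n))"
    proof (cases b)
      case True
      then show ?thesis unfolding lawG combine_def[of harm] by (simp add: case_prod_unfold)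
    next
      case False
      \<comment> \<open>A series uses only the first of the two sampled paths, whose law is the
        marginal.\<close>
      have "map_pmf (\<lambda>(a, b). a) (pair_pmf X Y) = X" for X Y :: "real pmf"
        using map_fst_pair_pmf[of X Y] by (simp add: case_prod_unfold)
      with False show ?thesis unfolding lawG by simp
    qed
  qed
  finally show ?case unfolding choices by (simp add: law_def)
qed

text \<open>A function of finitely many finitely valued coordinates is a finite combination of
  indicators of cylinder events, whose probabilities factorise by independence.\<close>

lemma (in prob_space) expectation_indep_discrete:
  fixes X :: "'i \<Rightarrow> 'a \<Rightarrow> 'b :: finite" and h :: "('i \<Rightarrow> 'b) \<Rightarrow> real"
  assumes indep: "indep_vars (\<lambda>_. count_space UNIV) X UNIV" and fin: "finite I"
    and distr: "\<And>i b. prob {\<omega> \<in> space M. X i \<omega> = b} = pmf (P i) b"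
    and dep: "\<And>f g. (\<And>x. x \<in> I \<Longrightarrow> f x = g x) \<Longrightarrow> h f = h g"
  shows "integrable M (\<lambda>\<omega>. h (\<lambda>i. X i \<omega>))"
    and "(\<integral>\<omega>. h (\<lambda>i. X i \<omega>) \<partial>M) = measure_pmf.expectation (Pi_pmf I dflt P) h"
proof -
  \<comment> \<open>One representative for each assignment on \<open>I\<close>, extended by the
    default value just as in \<open>Pi_pmf\<close>.\<close>
  define A where "A = PiE_dflt I dflt (\<lambda>_. UNIV :: 'b set)"
  define S where "S f = {\<omega> \<in> space M. \<forall>i\<in>I. X i \<omega> = f i}" for f
  have finA: "finite A" unfolding A_def using fin by (intro finite_PiE_dflt) auto
  have rv: "X i \<in> measurable M (count_space UNIV)" for i
    using indep by (auto simp: indep_vars_def)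
  have [measurable]: "{\<omega> \<in> space M. X i \<omega> = b} \<in> events" for i b
    using measurable_sets[OF rv[of i], of "{b}"] by (simp add: vimage_def Int_def conj_commute)
  have S: "S f \<in> events" for f
    unfolding S_def using fin by measurable
  have prob_S: "prob (S f) = pmf (Pi_pmf I dflt P) f" if "f \<in> A" for f
  proof -
    have "pmf (Pi_pmf I dflt P) f = (\<Prod>i\<in>I. pmf (P i) (f i))"
      using that by (intro pmf_Pi' fin) (auto simp: A_def PiE_dflt_def)
    also have "\<dots> = prob (S f)"
    proof (cases "I = {}")
      case True
      then show ?thesis by (simp add: S_def prob_space)
    next
      case False
      have "prob (\<Inter>i\<in>I. X i -` {f i} \<inter> space M) = (\<Prod>i\<in>I. prob (X i -` {f i} \<inter> space M))"
        by (rule indep_varsD[OF indep False fin]) auto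
      moreover have "(\<Inter>i\<in>I. X i -` {f i} \<inter> space M) = S f"
        using False by (auto simp: S_def)
      moreover have "prob (X i -` {f i} \<inter> space M) = pmf (P i) (f i)" for i
        unfolding distr[symmetric] by (rule arg_cong[where f = prob]) auto
      ultimately show ?thesis by simp
    qed
    finally show ?thesis ..
  qed
  have eq: "h (\<lambda>i. X i \<omega>) = (\<Sum>f\<in>A. h f * indicator (S f) \<omega>)" if "\<omega> \<in> space M" for \<omega>
  proof -
    define f0 where "f0 i = (if i \<in> I then X i \<omega> else dflt)" for i
    have f0: "f0 \<in> A" by (auto simp: A_def PiE_dflt_def f0_def)
    have "\<omega> \<in> S f \<longleftrightarrow> f = f0" if "f \<in> A" for f
    proof
      assume "\<omega> \<in> S f"
      with that show "f = f0"
        by (intro ext) (auto simp: S_def A_def PiE_dflt_def f0_def)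
    qed (use \<open>\<omega> \<in> space M\<close> in \<open>auto simp: S_def f0_def\<close>)
    then have "indicator (S f) \<omega> = (if f = f0 then 1 else 0 :: real)" if "f \<in> A" for f
      using that by (simp add: indicator_def)
    then have "(\<Sum>f\<in>A. h f * indicator (S f) \<omega>) = (\<Sum>f\<in>A. if f = f0 then h f else 0)"
      by (intro sum.cong) auto
    also have "\<dots> = h f0" using f0 finA by simp
    also have "\<dots> = h (\<lambda>i. X i \<omega>)" by (rule dep) (simp add: f0_def)
    finally show ?thesis ..
  qed
  have int: "integrable M (\<lambda>\<omega>. h f * indicator (S f) \<omega>)" for f
    using S by (intro integrable_mult_right integrable_real_indicator) (auto simp: emeasure_eq_measure)
  show "integrable M (\<lambda>\<omega>. h (\<lambda>i. X i \<omega>))"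
    using int by (subst Bochner_Integration.integrable_cong[OF refl eq]) auto
  have "(\<integral>\<omega>. h (\<lambda>i. X i \<omega>) \<partial>M) = (\<integral>\<omega>. (\<Sum>f\<in>A. h f * indicator (S f) \<omega>) \<partial>M)"
    by (intro Bochner_Integration.integral_cong refl eq)
  also have "\<dots> = (\<Sum>f\<in>A. h f * prob (S f))"
    using int S by (simp add: Int_absorb2 sets.sets_into_space)
  also have "\<dots> = (\<Sum>f\<in>A. h f * pmf (Pi_pmf I dflt P) f)"
    using prob_S by simp
  also have "\<dots> = measure_pmf.expectation (Pi_pmf I dflt P) h"
    using finA fin by (subst integral_measure_pmf[of A])
      (auto simp: A_def set_Pi_pmf PiE_dflt_def mult.commute set_pmf_iff pmf_Pi)
  finally show "(\<integral>\<omega>. h (\<lambda>i. X i \<omega>) \<partial>M) = measure_pmf.expectation (Pi_pmf I dflt P) h" .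
qed

instance motif :: finite
proof
  have *: "(UNIV :: motif set) = {Diamond, Series}"
    using motif.exhaust by auto
  show "finite (UNIV :: motif set)" unfolding * by simp
qed

text \<open>\<open>h\<close> is arbitrary because the resistance is determined by finitely many
  finitely valued choices. From here on only the explicit law matters.\<close>

lemma
  assumes "diamond_series_process M p c" "0 < p" "p < 1"
  shows integrable_resistance: "integrable M (\<lambda>\<omega>. h (resistance c n \<omega>) :: real)"
    and expectation_resistance:
      "(\<integral>\<omega>. h (resistance c n \<omega>) \<partial>M) = measure_pmf.expectation (law (p_diamond p) n) h"
proof -
  interpret diamond_series_process M p c by fact
  let ?e = "(End_a, End_b)"
  define X where "X = (\<lambda>(n, e). c n e)"
  have indep: "indep_vars (\<lambda>_. count_space UNIV) X UNIV"
    using indep_choices by (simp add: X_def)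
  have q: "0 \<le> p_diamond p" "p_diamond p \<le> 1"
    using prob_Diamond[of 0 ?e] measure_nonneg[of M] prob_le_1 by metis+
  have distr: "prob {\<omega> \<in> space M. X i \<omega> = b} = pmf (motif_pmf (p_diamond p)) b" for i b
  proof -
    have "pmf (motif_pmf (p_diamond p)) Diamond = p_diamond p"
      "pmf (motif_pmf (p_diamond p)) Series = 1 - p_diamond p"
      using q pmf_map_inj'[of "\<lambda>b. if b then Diamond else Series" "bernoulli_pmf (p_diamond p)" True]
        pmf_map_inj'[of "\<lambda>b. if b then Diamond else Series" "bernoulli_pmf (p_diamond p)" False]
      by (simp_all add: motif_pmf_def inj_def)
    then show ?thesis
      using prob_Diamond[of "fst i" "snd i"] prob_Series[of "fst i" "snd i"]
        p_series_eq[OF assms(2,3)]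
      by (cases b) (simp_all add: X_def case_prod_unfold)
  qed
  have dep: "h (res f n 0 ?e) = h (res g n 0 ?e)" if "\<And>x. x \<in> choices n 0 ?e \<Longrightarrow> f x = g x" for f g
    using that by (metis res_cong)
  have R: "resistance c n \<omega> = res (\<lambda>i. X i \<omega>) n 0 ?e" for \<omega>
    by (simp add: resistance_eq_res X_def case_prod_unfold)
  note * = expectation_indep_discrete[where h = "\<lambda>f. h (res f n 0 ?e)", OF indep finite_choices distr dep]
  show "integrable M (\<lambda>\<omega>. h (resistance c n \<omega>) :: real)"
    unfolding R by (rule *(1)) auto
  have "(\<integral>\<omega>. h (resistance c n \<omega>) \<partial>M) = measure_pmf.expectation
      (Pi_pmf (choices n 0 ?e) Series (\<lambda>_. motif_pmf (p_diamond p))) (\<lambda>f. h (res f n 0 ?e))"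
    unfolding R by (rule *(2)) auto
  also have "\<dots> = measure_pmf.expectation (law (p_diamond p) n) h"
    by (subst map_res_Pi_pmf[of End_a End_b n 0, symmetric]) simp_all
  finally show "(\<integral>\<omega>. h (resistance c n \<omega>) \<partial>M) = measure_pmf.expectation (law (p_diamond p) n) h" .
qed

section \<open>Increasing concave order and the mean\<close>

abbreviation E :: "'a pmf \<Rightarrow> ('a \<Rightarrow> real) \<Rightarrow> real" where
  "E \<equiv> measure_pmf.expectation"

section \<open>Expectations under finitely supported laws\<close>

lemma E_eq_sum: "finite (set_pmf \<mu>) \<Longrightarrow> E \<mu> f = (\<Sum>x\<in>set_pmf \<mu>. pmf \<mu> x * f x)"
  by (subst integral_measure_pmf[of "set_pmf \<mu>"]) auto

lemma E_mono:
  assumes "finite (set_pmf \<mu>)" "\<And>x. x \<in> set_pmf \<mu> \<Longrightarrow> f x \<le> g x"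
  shows "E \<mu> f \<le> E \<mu> g"
  using assms by (auto simp: E_eq_sum intro!: sum_mono mult_left_mono)

lemma set_combine: "set_pmf (combine op \<mu> \<nu>) = (\<lambda>(x, y). op x y) ` (set_pmf \<mu> \<times> set_pmf \<nu>)"
  by (simp add: combine_def)

lemma E_combine:
  assumes "finite (set_pmf \<mu>)" "finite (set_pmf \<nu>)"
  shows "E (combine op \<mu> \<nu>) f = E \<mu> (\<lambda>x. E \<nu> (\<lambda>y. f (op x y)))"
proof -
  have "combine op \<mu> \<nu> = bind_pmf \<mu> (\<lambda>x. map_pmf (op x) \<nu>)"
    by (simp add: combine_def pair_pmf_def map_bind_pmf map_pmf_def bind_assoc_pmf bind_return_pmf)
  then show ?thesis
    using assms by (simp add: pmf_expectation_bind[of "set_pmf \<mu>"] E_eq_sum[of \<mu>])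
qed

lemma set_step_law:
  "set_pmf (step_law q s d \<nu>) \<subseteq>
     set_pmf (combine d (combine s \<nu> \<nu>) (combine s \<nu> \<nu>)) \<union> set_pmf (combine s \<nu> \<nu>)"
  by (auto simp: step_law_def split: if_splits)

lemma E_step_law:
  assumes "finite (set_pmf \<nu>)" "0 \<le> q" "q \<le> 1"
  shows "E (step_law q s d \<nu>) f =
    q * E (combine d (combine s \<nu> \<nu>) (combine s \<nu> \<nu>)) f + (1 - q) * E (combine s \<nu> \<nu>) f"
  unfolding step_law_def using assms
  by (subst pmf_expectation_bind[of UNIV]) (auto simp: set_combine UNIV_bool)

text \<open>Finite support makes every function integrable; on the positive half line
  \<open>harm\<close> is increasing and concave in each argument.\<close>

definition pos_law :: "real pmf \<Rightarrow> bool" where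
  "pos_law \<mu> \<longleftrightarrow> finite (set_pmf \<mu>) \<and> set_pmf \<mu> \<subseteq> {0<..}"

definition pos_op :: "(real \<Rightarrow> real \<Rightarrow> real) \<Rightarrow> bool" where
  "pos_op op \<longleftrightarrow> (\<forall>x>0. \<forall>y>0. op x y > 0)"

lemma pos_law_combine: "pos_op op \<Longrightarrow> pos_law \<mu> \<Longrightarrow> pos_law \<nu> \<Longrightarrow> pos_law (combine op \<mu> \<nu>)"
  unfolding pos_law_def pos_op_def set_combine by (auto simp: subset_iff)

lemma pos_law_step:
  assumes "pos_op s" "pos_op d" "pos_law \<nu>"
  shows "pos_law (step_law q s d \<nu>)"
proof -
  have "pos_law (combine s \<nu> \<nu>)" "pos_law (combine d (combine s \<nu> \<nu>) (combine s \<nu> \<nu>))"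
    using assms by (auto intro!: pos_law_combine)
  then show ?thesis
    using set_step_law[of q s d \<nu>] unfolding pos_law_def by (meson Un_least finite_UnI finite_subset subset_trans)
qed

text \<open>Second-order stochastic dominance for laws on the positive half line.\<close>

definition icv_le :: "real pmf \<Rightarrow> real pmf \<Rightarrow> bool" where
  "icv_le \<mu> \<nu> \<longleftrightarrow> (\<forall>f. concave_on {0<..} f \<longrightarrow> mono_on {0<..} f \<longrightarrow> E \<mu> f \<le> E \<nu> f)"

text \<open>Concavity in each argument separately suffices: the arguments are independent and get
  exchanged one at a time.\<close>

definition icv_op :: "(real \<Rightarrow> real \<Rightarrow> real) \<Rightarrow> bool" where
  "icv_op op \<longleftrightarrow> pos_op op \<and>
     (\<forall>c>0. concave_on {0<..} (\<lambda>x. op x c) \<and> mono_on {0<..} (\<lambda>x. op x c)) \<and>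
     (\<forall>c>0. concave_on {0<..} (\<lambda>x. op c x) \<and> mono_on {0<..} (\<lambda>x. op c x))"

lemma concave_mono_compose:
  fixes f g :: "real \<Rightarrow> real"
  assumes "concave_on S f" "mono_on S f" "concave_on T g" "mono_on T g" "g ` T \<subseteq> S"
  shows "concave_on T (\<lambda>x. f (g x))" "mono_on T (\<lambda>x. f (g x))"
proof -
  have cS: "convex S" "convex T" using assms concave_on_imp_convex by blast+
  show "concave_on T (\<lambda>x. f (g x))"
    unfolding concave_on_iff
  proof (intro conjI ballI allI impI cS)
    fix x y u v :: real
    assume *: "x \<in> T" "y \<in> T" "0 \<le> u" "0 \<le> v" "u + v = 1"
    have gS: "g x \<in> S" "g y \<in> S" "g (u *\<^sub>R x + v *\<^sub>R y) \<in> S"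
      using *(1,2) convexD[OF cS(2) *] assms(5) by blast+
    have "u * f (g x) + v * f (g y) \<le> f (u *\<^sub>R g x + v *\<^sub>R g y)"
      using assms(1) * gS by (auto simp: concave_on_iff)
    also have "\<dots> \<le> f (g (u *\<^sub>R x + v *\<^sub>R y))"
    proof (rule mono_onD[OF assms(2)])
      show "u *\<^sub>R g x + v *\<^sub>R g y \<in> S" using convexD[OF cS(1) gS(1,2)] * by blast
      show "u *\<^sub>R g x + v *\<^sub>R g y \<le> g (u *\<^sub>R x + v *\<^sub>R y)"
        using assms(3) * by (auto simp: concave_on_iff)
    qed (fact gS)
    finally show "u * f (g x) + v * f (g y) \<le> f (g (u *\<^sub>R x + v *\<^sub>R y))" .
  qed
  show "mono_on T (\<lambda>x. f (g x))"
  proof (rule mono_onI)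
    fix x y assume "x \<in> T" "y \<in> T" "x \<le> y"
    then have "g x \<le> g y" "g x \<in> S" "g y \<in> S" using assms(4,5) by (auto dest: mono_onD)
    then show "f (g x) \<le> f (g y)" using mono_onD[OF assms(2)] by blast
  qed
qed

lemma icv_op_flip: "icv_op op \<Longrightarrow> icv_op (\<lambda>x y. op y x)"
  by (auto simp: icv_op_def pos_op_def)

lemma combine_flip: "combine op \<mu> \<nu> = combine (\<lambda>x y. op y x) \<nu> \<mu>"
  unfolding combine_def by (subst pair_commute_pmf) (simp add: map_pmf_comp case_prod_unfold)

text \<open>For a fixed first argument \<open>x\<close>, the test function composed with
  \<open>op x\<close> is again increasing and concave, hence admissible for the given
  comparison.\<close>

lemma icv_le_combine_right:
  assumes op: "icv_op op" and pos: "pos_law \<mu>" "pos_law \<nu>" "pos_law \<nu>'" and le: "icv_le \<nu> \<nu>'"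
  shows "icv_le (combine op \<mu> \<nu>) (combine op \<mu> \<nu>')"
  unfolding icv_le_def
proof (intro allI impI)
  fix f :: "real \<Rightarrow> real" assume f: "concave_on {0<..} f" "mono_on {0<..} f"
  have fin: "finite (set_pmf \<mu>)" "finite (set_pmf \<nu>)" "finite (set_pmf \<nu>')"
    using pos by (auto simp: pos_law_def)
  show "E (combine op \<mu> \<nu>) f \<le> E (combine op \<mu> \<nu>') f"
    unfolding E_combine[OF fin(1,2)] E_combine[OF fin(1,3)]
  proof (rule E_mono[OF fin(1)])
    fix x assume "x \<in> set_pmf \<mu>"
    then have x: "x > 0" using pos by (auto simp: pos_law_def)
    have "concave_on {0<..} (op x)" "mono_on {0<..} (op x)" "op x ` {0<..} \<subseteq> {0<..}"
      using op x by (auto simp: icv_op_def pos_op_def)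
    from concave_mono_compose[OF f this] le show "E \<nu> (\<lambda>y. f (op x y)) \<le> E \<nu>' (\<lambda>y. f (op x y))"
      by (simp add: icv_le_def)
  qed
qed

lemma icv_le_trans: "icv_le \<mu> \<nu> \<Longrightarrow> icv_le \<nu> \<rho> \<Longrightarrow> icv_le \<mu> \<rho>"
  unfolding icv_le_def by (meson order_trans)

lemma icv_le_combine:
  assumes "icv_op op" "pos_law \<mu>" "pos_law \<mu>'" "pos_law \<nu>" "pos_law \<nu>'" "icv_le \<mu> \<mu>'" "icv_le \<nu> \<nu>'"
  shows "icv_le (combine op \<mu> \<nu>) (combine op \<mu>' \<nu>')"
proof (rule icv_le_trans)
  show "icv_le (combine op \<mu> \<nu>) (combine op \<mu> \<nu>')"
    using assms by (intro icv_le_combine_right)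
  show "icv_le (combine op \<mu> \<nu>') (combine op \<mu>' \<nu>')"
    unfolding combine_flip[of op \<mu> \<nu>'] combine_flip[of op \<mu>' \<nu>']
    using assms by (intro icv_le_combine_right icv_op_flip[OF assms(1)])
qed

lemma icv_le_step:
  assumes s: "icv_op s" and d: "icv_op d" and pos: "pos_law \<nu>" "pos_law \<nu>'" and le: "icv_le \<nu> \<nu>'"
    and q: "0 \<le> q" "q \<le> 1"
  shows "icv_le (step_law q s d \<nu>) (step_law q s d \<nu>')"
proof -
  have ps: "pos_op s" using s by (simp add: icv_op_def)
  have A: "icv_le (combine s \<nu> \<nu>) (combine s \<nu>' \<nu>')"
    using s pos le by (intro icv_le_combine)
  moreover have "icv_le (combine d (combine s \<nu> \<nu>) (combine s \<nu> \<nu>)) (combine d (combine s \<nu>' \<nu>') (combine s \<nu>' \<nu>'))"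
    by (intro icv_le_combine[OF d] pos_law_combine ps pos A)
  ultimately show ?thesis
    using pos q unfolding icv_le_def pos_law_def by (simp add: E_step_law add_mono mult_left_mono)
qed

lemma pos_law_step_iterate:
  assumes "pos_op s" "pos_op d" "pos_law \<nu>"
  shows "pos_law ((step_law q s d ^^ n) \<nu>)"
  by (induction n) (simp_all add: assms pos_law_step)

lemma icv_le_step_iterate:
  assumes "icv_op s" "icv_op d" "pos_law \<nu>" "pos_law \<nu>'" "icv_le \<nu> \<nu>'" "0 \<le> q" "q \<le> 1"
  shows "icv_le ((step_law q s d ^^ n) \<nu>) ((step_law q s d ^^ n) \<nu>')"
proof (induction n)
  case (Suc n)
  have "pos_op s" "pos_op d" using assms by (auto simp: icv_op_def)
  with Suc assms show ?case
    by (simp add: icv_le_step pos_law_step_iterate)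
qed (simp add: assms)

text \<open>Jensen's inequality.\<close>

lemma icv_le_mean:
  assumes "pos_law \<nu>"
  shows "icv_le \<nu> (return_pmf (E \<nu> (\<lambda>x. x)))"
  unfolding icv_le_def
proof (intro allI impI)
  fix f :: "real \<Rightarrow> real" assume f: "concave_on {0<..} f"
  have "- f (E \<nu> (\<lambda>x. x)) \<le> E \<nu> (\<lambda>x. - f x)"
    by (rule measure_pmf.jensens_inequality[where I = "{0<..}"])
      (use assms f in \<open>auto simp: pos_law_def AE_measure_pmf_iff concave_on_def intro: integrable_measure_pmf_finite\<close>)
  then show "E \<nu> f \<le> E (return_pmf (E \<nu> (\<lambda>x. x))) f" by simp
qed

lemma map_combine:
  assumes "\<And>x y. \<phi> (op x y) = op' (\<phi> x) (\<phi> y)"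
  shows "map_pmf \<phi> (combine op \<mu> \<nu>) = combine op' (map_pmf \<phi> \<mu>) (map_pmf \<phi> \<nu>)"
  by (simp add: combine_def pair_map_pmf1 pair_map_pmf2 map_pmf_comp case_prod_unfold assms)

text \<open>Used with two maps: scaling by a constant, which commutes with both connections, and
  \<open>inverse\<close>, which exchanges them and so passes from resistances to
  conductances.\<close>

lemma map_step_iterate:
  assumes "\<And>x y. \<phi> (s x y) = s' (\<phi> x) (\<phi> y)" "\<And>x y. \<phi> (d x y) = d' (\<phi> x) (\<phi> y)"
  shows "map_pmf \<phi> ((step_law q s d ^^ n) \<nu>) = (step_law q s' d' ^^ n) (map_pmf \<phi> \<nu>)"
proof (induction n)
  case (Suc n)
  have "map_pmf \<phi> (step_law q s d \<mu>) = step_law q s' d' (map_pmf \<phi> \<mu>)" for \<mu>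
    unfolding step_law_def map_bind_pmf
    by (intro bind_pmf_cong refl) (simp add: map_combine[of \<phi> s s', OF assms(1)] map_combine[of \<phi> d d', OF assms(2)])
  then show ?case using Suc by simp
qed simp

section \<open>Addition and parallel connection as increasing concave operations\<close>

lemma icv_op_add: "icv_op (+)"
  by (auto simp: icv_op_def pos_op_def concave_on_ident concave_on_const mono_on_def intro!: concave_on_add)

lemma harm_pos: "x > 0 \<Longrightarrow> y > 0 \<Longrightarrow> harm x y > 0"
  by (simp add: harm_def add_pos_pos)

lemma harm_commute: "harm x y = harm y x"
  by (simp add: harm_def add.commute)

lemma harm_mono: "0 < x \<Longrightarrow> x \<le> x' \<Longrightarrow> 0 < y \<Longrightarrow> y \<le> y' \<Longrightarrow> harm x y \<le> harm x' y'"
  unfolding harm_def by (intro le_imp_inverse_le add_mono add_pos_pos) auto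

lemma harm_altdef:
  assumes "x > 0" "y > 0"
  shows "harm x y = x * y / (x + y)"
  using assms by (simp add: harm_def field_simps)

lemma mult_harm: "c * harm x y = harm (c * x) (c * y)"
  by (simp add: harm_def flip: distrib_left)

text \<open>For positive \<open>x\<close> one has \<open>harm x c = c - c^2 / (x + c)\<close>, and
  the subtracted term is convex.\<close>

lemma concave_on_harm:
  assumes "c > 0"
  shows "concave_on {0<..} (\<lambda>x. harm x c)"
proof -
  have "convex_on {0<..} (\<lambda>x. c\<^sup>2 * inverse (x + c) - c)"
  proof (rule f''_ge0_imp_convex[where f' = "\<lambda>x. - c\<^sup>2 / (x + c)\<^sup>2" and f'' = "\<lambda>x. 2 * c\<^sup>2 / (x + c) ^ 3"])
    fix x :: real assume "x \<in> {0<..}"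
    with assms have x: "x + c > 0" "x + c \<noteq> 0" by auto
    show "((\<lambda>x. c\<^sup>2 * inverse (x + c) - c) has_real_derivative - c\<^sup>2 / (x + c)\<^sup>2) (at x)"
      using x by (auto intro!: derivative_eq_intros simp: power2_eq_square field_simps)
    show "((\<lambda>x. - c\<^sup>2 / (x + c)\<^sup>2) has_real_derivative 2 * c\<^sup>2 / (x + c) ^ 3) (at x)"
      using x by (auto intro!: derivative_eq_intros simp: divide_simps eval_nat_numeral)
    show "0 \<le> 2 * c\<^sup>2 / (x + c) ^ 3" using x by simp
  qed auto
  then have cvx: "c\<^sup>2 * inverse (u * x + v * y + c) - c \<le>
      u * (c\<^sup>2 * inverse (x + c) - c) + v * (c\<^sup>2 * inverse (y + c) - c)"
    if "x > 0" "y > 0" "u \<ge> 0" "v \<ge> 0" "u + v = 1" for x y u v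
    using that by (auto simp: convex_on_def)
  have eq: "harm x c = - (c\<^sup>2 * inverse (x + c) - c)" if "x > 0" for x
    using that assms by (simp add: harm_altdef field_simps power2_eq_square)
  show ?thesis
    unfolding concave_on_iff
  proof (intro conjI ballI allI impI)
    fix x y u v :: real
    assume *: "x \<in> {0<..}" "y \<in> {0<..}" "0 \<le> u" "0 \<le> v" "u + v = 1"
    then have "u *\<^sub>R x + v *\<^sub>R y \<in> {0<..}"
      using convexD[of "{0::real<..}" x y u v] by simp
    then show "u * harm x c + v * harm y c \<le> harm (u *\<^sub>R x + v *\<^sub>R y) c"
      using * cvx[of x y u v] by (simp add: eq algebra_simps)
  qed simp
qed

lemma icv_op_harm: "icv_op harm"
  unfolding icv_op_def pos_op_def
  using concave_on_harm by (auto simp: harm_pos harm_commute[of _ "_ :: real"] mono_on_def intro!: harm_mono)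

lemma pos_law_law: "pos_law (law q n)"
  unfolding law_def using icv_op_add icv_op_harm
  by (intro pos_law_step_iterate) (auto simp: icv_op_def pos_law_def)

lemma finite_law: "finite (set_pmf (law q n))" and law_pos: "x \<in> set_pmf (law q n) \<Longrightarrow> x > 0"
  using pos_law_law[of q n] by (auto simp: pos_law_def)

lemma law_Suc: "law q (Suc n) = step_law q (+) harm (law q n)"
  by (simp add: law_def)

text \<open>Sums of two values from \<open>{1..2 ^ n}\<close> lie in \<open>{2..2 ^ Suc n}\<close>,
  and the parallel connection of two such sums is at least 1. This makes the logarithms nonnegative
  and confines the limit to \<open>{0..ln 2}\<close>.\<close>

lemma set_law: "set_pmf (law q n) \<subseteq> {1..2 ^ n}"
proof (induction n)
  case 0
  then show ?case by (simp add: law_def)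
next
  case (Suc n)
  have A: "set_pmf (combine (+) (law q n) (law q n)) \<subseteq> {2..2 ^ Suc n}"
  proof
    fix z assume "z \<in> set_pmf (combine (+) (law q n) (law q n))"
    then obtain x y where "x \<in> set_pmf (law q n)" "y \<in> set_pmf (law q n)" "z = x + y"
      by (auto simp: set_combine)
    then have "x \<in> {1..2 ^ n}" "y \<in> {1..2 ^ n}" "z = x + y" using Suc by blast+
    then show "z \<in> {2..2 ^ Suc n}" by auto
  qed
  have harm2: "harm x x = x / 2" for x :: real by (simp add: harm_def)
  have "harm x y \<in> {1..2 ^ Suc n}" if "x \<in> {2..2 ^ Suc n}" "y \<in> {2..2 ^ Suc n}" for x y
    using that harm_mono[of 2 x 2 y] harm_mono[of x "2 ^ Suc n" y "2 ^ Suc n"]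
    by (simp add: harm2)
  then have "set_pmf (combine harm (combine (+) (law q n) (law q n)) (combine (+) (law q n) (law q n))) \<subseteq> {1..2 ^ Suc n}"
    (is "?H \<subseteq> _")
  proof (intro subsetI)
    fix z assume "z \<in> ?H"
    then obtain x y where "x \<in> set_pmf (combine (+) (law q n) (law q n))"
      "y \<in> set_pmf (combine (+) (law q n) (law q n))" "z = harm x y"
      by (auto simp: set_combine[of harm])
    then show "z \<in> {1..2 ^ Suc n}"
      using A \<open>\<And>x y. _ \<Longrightarrow> _ \<Longrightarrow> harm x y \<in> _\<close> by blast
  qed
  moreover have "set_pmf (combine (+) (law q n) (law q n)) \<subseteq> {1..2 ^ Suc n}"
    using A by auto
  ultimately show ?case
    unfolding law_Suc using set_step_law[of q "(+)" harm "law q n"] by (meson Un_least subset_trans)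
qed

section \<open>First and second moments of the resistance\<close>

definition mean :: "real \<Rightarrow> nat \<Rightarrow> real" where
  "mean q n = E (law q n) (\<lambda>x. x)"

lemma mean_bounds: "1 \<le> mean q n" "mean q n \<le> 2 ^ n"
proof -
  have "E (law q n) (\<lambda>_. 1) \<le> mean q n" "mean q n \<le> E (law q n) (\<lambda>_. 2 ^ n)"
    unfolding mean_def by (intro E_mono finite_law; use set_law[of q n] in force)+
  then show "1 \<le> mean q n" "mean q n \<le> 2 ^ n" by simp_all
qed

definition moment2 :: "real \<Rightarrow> nat \<Rightarrow> real" where
  "moment2 q n = E (law q n) (\<lambda>x. x\<^sup>2)"

context
  fixes q :: real
  assumes q: "0 \<le> q" "q \<le> 1"
begin

text \<open>Replacing the law after \<open>n\<close> steps by the point mass at its mean can only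
  raise the mean after \<open>m\<close> further steps; by homogeneity those steps then yield
  \<open>law q m\<close> scaled by \<open>mean q n\<close>.\<close>

lemma mean_submult: "mean q (m + n) \<le> mean q m * mean q n"
proof -
  let ?T = "step_law q (+) harm ^^ m"
  have ml: "pos_law (return_pmf (mean q n))"
    using mean_bounds[of q n] by (simp add: pos_law_def)
  have "icv_le (?T (law q n)) (?T (return_pmf (mean q n)))"
    using icv_op_add icv_op_harm pos_law_law ml icv_le_mean[OF pos_law_law[of q n]] q
    by (intro icv_le_step_iterate) (auto simp: mean_def)
  moreover have "?T (return_pmf (mean q n)) = map_pmf ((*) (mean q n)) (law q m)"
    unfolding law_def by (subst map_step_iterate[where s' = "(+)" and d' = harm])
      (simp_all add: distrib_left mult_harm)
  moreover have "?T (law q n) = law q (m + n)"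
    by (simp add: law_def funpow_add)
  ultimately have "icv_le (law q (m + n)) (map_pmf ((*) (mean q n)) (law q m))" by simp
  then have "mean q (m + n) \<le> E (map_pmf ((*) (mean q n)) (law q m)) (\<lambda>x. x)"
    unfolding mean_def[of q "m + n"] icv_le_def
    by (elim allE[of _ "\<lambda>x. x"]) (simp add: concave_on_ident mono_on_def)
  then show ?thesis by (simp add: mean_def[of q m] mult.commute)
qed

text \<open>The same comparison for conductances, whose law evolves with the two connections
  exchanged. Here the law after the first step is replaced by its mean and followed through
  \<open>n\<close> further steps.\<close>

lemma mean_Suc_ge: "2 / (1 + q) * mean q n \<le> mean q (Suc n)"
proof -
  let ?T = "step_law q harm (+)"
  \<comment> \<open>Mean conductance after one step: a diamond of unit edges has conductance 1, a
    series 1/2.\<close>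
  let ?c = "(1 + q) / 2"
  have inv: "(?T ^^ m) (return_pmf 1) = map_pmf inverse (law q m)" for m
    unfolding law_def by (subst map_step_iterate[where s' = harm and d' = "(+)"]) (auto simp: harm_def)
  have p1: "pos_law (return_pmf 1)" by (simp add: pos_law_def)
  have pT: "pos_law (?T (return_pmf 1))"
    using icv_op_add icv_op_harm p1 by (intro pos_law_step) (auto simp: icv_op_def)
  have c: "E (?T (return_pmf 1)) (\<lambda>x. x) = ?c"
    using q by (simp add: E_step_law E_combine set_combine harm_def field_simps)
  have "icv_le (?T (return_pmf 1)) (return_pmf ?c)"
    using icv_le_mean[OF pT] unfolding c .
  then have "icv_le ((?T ^^ n) (?T (return_pmf 1))) ((?T ^^ n) (return_pmf ?c))"
    using icv_op_add icv_op_harm pT q by (intro icv_le_step_iterate) (auto simp: pos_law_def)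
  moreover have "(?T ^^ n) (?T (return_pmf 1)) = map_pmf inverse (law q (Suc n))"
    by (simp only: inv[symmetric] funpow_Suc_right o_apply)
  moreover have "(?T ^^ n) (return_pmf ?c) = map_pmf ((*) ?c) ((?T ^^ n) (return_pmf 1))"
    by (subst map_step_iterate[where s' = harm and d' = "(+)"])
      (simp_all add: distrib_left mult_harm)
  ultimately have "icv_le (map_pmf inverse (law q (Suc n))) (map_pmf ((*) ?c) (map_pmf inverse (law q n)))"
    unfolding inv by simp
  \<comment> \<open>The test function that turns conductances back into resistances, with a sign
    that reverses the inequality.\<close>
  moreover have "concave_on {0<..} (\<lambda>x::real. - inverse x)"
    using convex_on_inverse[of "{0<..}"] by (simp add: concave_on_def)
  moreover have "mono_on {0<..} (\<lambda>x::real. - inverse x)"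
    by (auto simp: mono_on_def le_imp_inverse_le)
  ultimately have "E (map_pmf inverse (law q (Suc n))) (\<lambda>x. - inverse x)
      \<le> E (map_pmf ((*) ?c) (map_pmf inverse (law q n))) (\<lambda>x. - inverse x)"
    unfolding icv_le_def by blast
  moreover have "E (map_pmf inverse (law q (Suc n))) (\<lambda>x. - inverse x) = - mean q (Suc n)"
    by (simp add: mean_def)
  moreover have "E (map_pmf ((*) ?c) (map_pmf inverse (law q n))) (\<lambda>x. - inverse x) = - (2 / (1 + q) * mean q n)"
  proof -
    have "- inverse (?c * inverse x) = - (2 / (1 + q)) * x" for x
      by (simp only: inverse_mult_distrib inverse_inverse_eq inverse_divide minus_mult_left)
    then have "E (law q n) (\<lambda>x. - inverse (?c * inverse x)) = E (law q n) (\<lambda>x. - (2 / (1 + q)) * x)"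
      by (simp only:)
    then show ?thesis by (simp only: integral_map_pmf integral_mult_right_zero mean_def minus_mult_left)
  qed
  ultimately show ?thesis by linarith
qed

text \<open>
  The parallel term has no second moment on the right because \<open>harm x y\<close> is at most half the
  geometric mean of \<open>x\<close> and \<open>y\<close>, whose square factorises under independence.
\<close>

lemma moment2_Suc: "moment2 q (Suc n) \<le> q * (mean q n)\<^sup>2 + (1 - q) * (2 * moment2 q n + 2 * (mean q n)\<^sup>2)"
proof -
  let ?L = "law q n" and ?A = "combine (+) (law q n) (law q n)"
  have finL: "finite (set_pmf ?L)" by (rule finite_law)
  have intg: "integrable ?L f" for f :: "real \<Rightarrow> real" by (rule integrable_measure_pmf_finite[OF finL])
  have finA: "finite (set_pmf ?A)" using finL by (simp add: set_combine)
  have posA: "x > 0" if "x \<in> set_pmf ?A" for x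
    using that law_pos by (auto simp: set_combine add_pos_pos)
  have EA: "E ?A (\<lambda>x. x) = 2 * mean q n"
    by (simp add: E_combine finL mean_def intg)
  have "E ?A (\<lambda>x. x\<^sup>2) = E ?L (\<lambda>x. E ?L (\<lambda>y. x\<^sup>2 + y\<^sup>2 + 2 * x * y))"
    by (simp add: E_combine finL power2_sum)
  also have "\<dots> = 2 * moment2 q n + 2 * (mean q n)\<^sup>2"
    by (simp add: intg moment2_def mean_def power2_eq_square)
  finally have 1: "E ?A (\<lambda>x. x\<^sup>2) = 2 * moment2 q n + 2 * (mean q n)\<^sup>2" .
  have "E (combine harm ?A ?A) (\<lambda>x. x\<^sup>2) \<le> E ?A (\<lambda>x. E ?A (\<lambda>y. x * y / 4))"
    unfolding E_combine[OF finA finA]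
  proof (intro E_mono finA)
    fix x y assume "x \<in> set_pmf ?A" "y \<in> set_pmf ?A"
    then have xy: "x > 0" "y > 0" using posA by auto
    have "4 * (x * y) \<le> (x + y)\<^sup>2" using sum_squares_bound[of x y] by (simp add: power2_sum)
    then have "(x * y) * (4 * (x * y)) \<le> (x * y) * (x + y)\<^sup>2"
      using xy by (intro mult_left_mono) auto
    moreover have "P\<^sup>2 / S \<le> P / 4" if "S > 0" "P * (4 * P) \<le> P * S" for P S :: real
      using that by (simp add: field_simps power2_eq_square)
    ultimately have "(x * y)\<^sup>2 / (x + y)\<^sup>2 \<le> (x * y) / 4"
      using xy by simp
    then show "(harm x y)\<^sup>2 \<le> x * y / 4"
      using xy by (simp add: harm_altdef power_divide)
  qed
  also have "\<dots> = (mean q n)\<^sup>2"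
    by (simp add: EA power2_eq_square)
  finally show ?thesis
    unfolding moment2_def[of q "Suc n"] law_Suc E_step_law[OF finL q] 1[symmetric]
    using q by (intro add_mono mult_left_mono) auto
qed

text \<open>
  The induction closes exactly when \<open>(147 - 122 q) (1 + q)\<^sup>2 \<le> 194\<close>; the maximum of the left side is
  near \<open>q = 47/100\<close>, hence the square below.
\<close>

lemma moment2_le: "moment2 q n \<le> 97 / 50 * (mean q n)\<^sup>2"
proof (induction n)
  case 0
  then show ?case by (simp add: moment2_def mean_def law_def)
next
  case (Suc n)
  have "moment2 q (Suc n) \<le> q * (mean q n)\<^sup>2 + (1 - q) * (2 * (97 / 50 * (mean q n)\<^sup>2) + 2 * (mean q n)\<^sup>2)"
    using q by (intro order_trans[OF moment2_Suc] add_mono mult_left_mono Suc) auto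
  also have "\<dots> = (147 / 25 - 122 / 25 * q) * (mean q n)\<^sup>2"
    by (simp add: field_simps)
  also have "\<dots> \<le> (97 / 50 * (2 / (1 + q))\<^sup>2) * (mean q n)\<^sup>2"
  proof (rule mult_right_mono)
    have "97 / 50 * 4 - (147 / 25 - 122 / 25 * q) * (1 + q)\<^sup>2 =
        ((q - 47 / 100)\<^sup>2 * (122 * q + 5292 / 25) + 147 / 5000 * q + 14993 / 62500) / 25"
      by (simp add: power2_eq_square field_simps)
    also have "\<dots> \<ge> 0" using q by (intro divide_nonneg_nonneg add_nonneg_nonneg mult_nonneg_nonneg) auto
    finally have "(147 / 25 - 122 / 25 * q) * (1 + q)\<^sup>2 \<le> 97 / 50 * 4" by simp
    then show "147 / 25 - 122 / 25 * q \<le> 97 / 50 * (2 / (1 + q))\<^sup>2"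
      using q by (simp add: power_divide field_simps)
  qed simp
  also have "\<dots> = 97 / 50 * (2 / (1 + q) * mean q n)\<^sup>2"
    by (simp only: power_mult_distrib mult.assoc)
  also have "\<dots> \<le> 97 / 50 * (mean q (Suc n))\<^sup>2"
    using q mean_bounds[of q n] by (intro mult_left_mono power_mono mean_Suc_ge) auto
  finally show ?case .
qed

end

section \<open>Lower tail\<close>

lemma prob_eq_E: "measure_pmf.prob \<mu> A = E \<mu> (indicator A)"
  by simp

text \<open>Paley-Zygmund by a quadratic majorant of the indicator: it is at least 1 up to
  \<open>?m / 100\<close> and at least \<open>(1 - l * x)^2\<close> beyond. The bound lies below
  1/2, as the doubling in \<open>tail_law_iterate\<close> requires.\<close>

lemma prob_law_le_mean:
  assumes "0 \<le> q" "q \<le> 1"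
  shows "measure_pmf.prob (law q n) {..mean q n / 100} \<le> 99 / 200"
proof -
  let ?m = "mean q n"
  \<comment> \<open>Close to the minimiser of the resulting bound
    \<open>1 - 2 * t * 99/100 + 97/50 * t^2\<close> in \<open>t = l * ?m\<close>, which is
    \<open>t = 99/194\<close>.\<close>
  define l where "l = 51 / (100 * ?m)"
  have m: "?m > 0" using mean_bounds(1)[of q n] by linarith
  have intg: "integrable (law q n) f" for f :: "real \<Rightarrow> real"
    by (rule integrable_measure_pmf_finite[OF finite_law])
  have "measure_pmf.prob (law q n) {..?m / 100} \<le> E (law q n) (\<lambda>x. 1 - 2 * l * (x - ?m / 100) + l\<^sup>2 * x\<^sup>2)"
    unfolding prob_eq_E
  proof (rule E_mono[OF finite_law])
    fix x assume x: "x \<in> set_pmf (law q n)"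
    show "indicator {..?m / 100} x \<le> 1 - 2 * l * (x - ?m / 100) + l\<^sup>2 * x\<^sup>2"
    proof (cases "x \<le> ?m / 100")
      case True
      then have "2 * l * (x - ?m / 100) \<le> 0" using m by (intro mult_nonneg_nonpos) (auto simp: l_def)
      moreover have "0 \<le> l\<^sup>2 * x\<^sup>2" by simp
      moreover have "indicator {..?m / 100} x = (1 :: real)" using True by simp
      ultimately show ?thesis by linarith
    next
      case False
      have "0 \<le> (1 - l * x)\<^sup>2" by simp
      also have "\<dots> = 1 - 2 * l * x + l\<^sup>2 * x\<^sup>2" by (simp add: power2_eq_square algebra_simps)
      also have "\<dots> \<le> 1 - 2 * l * (x - ?m / 100) + l\<^sup>2 * x\<^sup>2"
      proof -
        have "0 \<le> l * ?m" using m by (simp add: l_def)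
        then show ?thesis by (simp add: algebra_simps)
      qed
      finally show ?thesis using False by simp
    qed
  qed
  also have "\<dots> = 1 - 2 * l * (?m - ?m / 100) + l\<^sup>2 * moment2 q n"
    using intg by (simp add: mean_def moment2_def)
  also have "\<dots> \<le> 1 - 2 * l * (?m - ?m / 100) + l\<^sup>2 * (97 / 50 * ?m\<^sup>2)"
    using moment2_le[OF assms, of n] by (intro add_left_mono mult_left_mono) auto
  also have "\<dots> = 1 - 2 * (l * ?m) * (99 / 100) + (l * ?m)\<^sup>2 * (97 / 50)"
    by (simp add: power_mult_distrib)
  also have "l * ?m = 51 / 100" using m by (simp add: l_def)
  finally show ?thesis by (simp add: power2_eq_square)
qed

lemma tail_combine_add:
  assumes "pos_law \<nu>"
  shows "measure_pmf.prob (combine (+) \<nu> \<nu>) {..x} \<le> (measure_pmf.prob \<nu> {..x})\<^sup>2"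
proof -
  have fin: "finite (set_pmf \<nu>)" using assms by (simp add: pos_law_def)
  have "E (combine (+) \<nu> \<nu>) (indicator {..x}) \<le> E \<nu> (\<lambda>a. E \<nu> (\<lambda>b. indicator {..x} a * indicator {..x} b))"
    unfolding E_combine[OF fin fin]
    by (intro E_mono fin) (use assms in \<open>force simp: pos_law_def indicator_def\<close>)
  then show ?thesis by (simp add: power2_eq_square)
qed

text \<open>A diamond of resistance at most \<open>x\<close> has a path of resistance at most
  \<open>2 * x\<close>; the union bound over the paths gives the factor 2. Both halves of that path
  are then at most \<open>2 * x\<close>, which gives the square. A series satisfies the same bound
  directly.\<close>

lemma tail_law_Suc:
  assumes q: "0 \<le> q" "q \<le> 1"
  shows "measure_pmf.prob (law q (Suc n)) {..x} \<le> 2 * (measure_pmf.prob (law q n) {..2 * x})\<^sup>2"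
proof (cases "x > 0")
  case False
  then have "set_pmf (law q (Suc n)) \<inter> {..x} = {}" using law_pos[of _ q "Suc n"] by force
  then show ?thesis by (simp add: measure_pmf_zero_iff[symmetric])
next
  case True
  let ?L = "law q n" and ?A = "combine (+) (law q n) (law q n)"
  let ?P = "measure_pmf.prob (law q n) {..2 * x}"
  have finL: "finite (set_pmf ?L)" by (rule finite_law)
  have finA: "finite (set_pmf ?A)" using finL by (simp add: set_combine)
  have intg: "integrable ?A f" for f :: "real \<Rightarrow> real" by (rule integrable_measure_pmf_finite[OF finA])
  have posA: "a > 0" if "a \<in> set_pmf ?A" for a
    using that law_pos by (auto simp: set_combine add_pos_pos)
  have A: "measure_pmf.prob ?A {..2 * x} \<le> ?P\<^sup>2" by (rule tail_combine_add[OF pos_law_law])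
  have S: "measure_pmf.prob ?A {..x} \<le> ?P\<^sup>2"
    by (rule order_trans[OF _ A]) (use True in \<open>intro measure_pmf.finite_measure_mono, auto\<close>)
  then have S2: "measure_pmf.prob ?A {..x} \<le> 2 * ?P\<^sup>2"
    using zero_le_power2[of ?P] by linarith
  have "E (combine harm ?A ?A) (indicator {..x}) \<le>
      E ?A (\<lambda>a. E ?A (\<lambda>b. indicator {..2 * x} a + indicator {..2 * x} b))"
    unfolding E_combine[OF finA finA]
  proof (intro E_mono finA)
    fix a b assume "a \<in> set_pmf ?A" "b \<in> set_pmf ?A"
    then have ab: "a > 0" "b > 0" using posA by auto
    \<comment> \<open>Otherwise expressed, two conductances below \<open>1 / (2 * x)\<close> add up
      to less than \<open>1 / x\<close>.\<close>
    have "x < harm a b" if "a > 2 * x" "b > 2 * x"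
    proof -
      have "inverse a < inverse (2 * x)" "inverse b < inverse (2 * x)"
        using that True by (auto intro!: less_imp_inverse_less simp del: inverse_mult_distrib)
      then have "inverse a + inverse b < inverse x" by simp
      from less_imp_inverse_less[OF this] ab show ?thesis by (simp add: harm_def add_pos_pos)
    qed
    then show "indicator {..x} (harm a b) \<le> (indicator {..2 * x} a + indicator {..2 * x} b :: real)"
      by (auto simp: indicator_def)
  qed
  also have "\<dots> = 2 * measure_pmf.prob ?A {..2 * x}"
    using intg by simp
  finally have D: "measure_pmf.prob (combine harm ?A ?A) {..x} \<le> 2 * ?P\<^sup>2"
    using A by simp
  have "measure_pmf.prob (law q (Suc n)) {..x} = q * measure_pmf.prob (combine harm ?A ?A) {..x} + (1 - q) * measure_pmf.prob ?A {..x}"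
    unfolding law_Suc prob_eq_E by (rule E_step_law[OF finL q])
  also have "\<dots> \<le> q * (2 * ?P\<^sup>2) + (1 - q) * (2 * ?P\<^sup>2)"
    using q D S2 by (intro add_mono mult_left_mono) auto
  finally show ?thesis by (simp add: algebra_simps)
qed

text \<open>Doubling the probability absorbs the factor 2 in \<open>tail_law_Suc\<close>: the
  doubled tail is squared at each step.\<close>

lemma tail_law_iterate:
  assumes q: "0 \<le> q" "q \<le> 1"
  shows "2 * measure_pmf.prob (law q (n + k)) {..x / 2 ^ k} \<le> (2 * measure_pmf.prob (law q n) {..x}) ^ 2 ^ k"
proof (induction k)
  case (Suc k)
  have "2 * measure_pmf.prob (law q (n + Suc k)) {..x / 2 ^ Suc k} \<le>
      (2 * measure_pmf.prob (law q (n + k)) {..x / 2 ^ k})\<^sup>2"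
    using tail_law_Suc[OF q, of "n + k" "x / 2 ^ Suc k"] by (simp add: power2_eq_square)
  also have "\<dots> \<le> ((2 * measure_pmf.prob (law q n) {..x}) ^ 2 ^ k)\<^sup>2"
    by (intro power_mono Suc) simp
  also have "\<dots> = (2 * measure_pmf.prob (law q n) {..x}) ^ 2 ^ Suc k"
    by (metis power_mult power_Suc2)
  finally show ?case .
qed simp

text \<open>The iteration starts \<open>k\<close> generations earlier from the fixed bound 99/200.
  One factor \<open>2 ^ k\<close> of the level comes from the iteration, the other from the growth
  of the mean over those generations.\<close>

lemma tail_law_mean:
  assumes q: "0 \<le> q" "q \<le> 1" and k: "k \<le> n"
  shows "measure_pmf.prob (law q n) {..mean q n / (100 * 4 ^ k)} \<le> (99 / 100) ^ 2 ^ k"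
proof -
  obtain m where n: "n = m + k" using k by (metis le_add_diff_inverse2)
  have "mean q n \<le> mean q m * 2 ^ k"
    unfolding n using mean_bounds[of q m] mean_bounds[of q k]
    by (intro order_trans[OF mean_submult[OF q]] mult_left_mono) auto
  moreover have "(4 :: real) ^ k = 2 ^ k * 2 ^ k" by (simp flip: power_mult_distrib)
  ultimately have "mean q n / (100 * 4 ^ k) \<le> mean q m / 100 / 2 ^ k"
    by (simp add: field_simps)
  then have "2 * measure_pmf.prob (law q n) {..mean q n / (100 * 4 ^ k)} \<le>
      2 * measure_pmf.prob (law q (m + k)) {..mean q m / 100 / 2 ^ k}"
    unfolding n by (intro mult_left_mono measure_pmf.finite_measure_mono) auto
  also have "\<dots> \<le> (2 * measure_pmf.prob (law q m) {..mean q m / 100}) ^ 2 ^ k"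
    by (rule tail_law_iterate[OF q])
  also have "\<dots> \<le> (99 / 100) ^ 2 ^ k"
    using prob_law_le_mean[OF q, of m] by (intro power_mono) auto
  finally show ?thesis
    using measure_nonneg[of "law q n" "{..mean q n / (100 * 4 ^ k)}"] by linarith
qed

section \<open>Convergence\<close>

text \<open>Fekete's lemma: the limit is the infimum of the quotients, finite by nonnegativity.
  Division with remainder by a nearly optimal \<open>m\<close> gives the upper estimate.\<close>

lemma fekete_nonneg:
  fixes u :: "nat \<Rightarrow> real"
  assumes sub: "\<And>m n. u (m + n) \<le> u m + u n" and nonneg: "\<And>n. 0 \<le> u n"
  obtains l where "0 \<le> l" "l \<le> u 1" "(\<lambda>n. u n / real n) \<longlonglongrightarrow> l"
proof -
  define l where "l = (INF n\<in>{1..}. u n / real n)"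
  have bdd: "bdd_below ((\<lambda>n. u n / real n) ` {1..})"
    using nonneg by (intro bdd_belowI[of _ 0]) auto
  have lower: "l \<le> u n / real n" if "n \<ge> 1" for n
    unfolding l_def using that bdd by (intro cINF_lower) auto
  have "0 \<le> l" unfolding l_def using nonneg by (intro cINF_greatest) auto
  have mult: "u (k * m + r) \<le> real k * u m + u r" for k m r
  proof (induction k)
    case (Suc k)
    have "u (m + (k * m + r)) \<le> u m + u (k * m + r)" by (rule sub)
    with Suc show ?case by (simp add: algebra_simps)
  qed simp
  have "(\<lambda>n. u n / real n) \<longlonglongrightarrow> l"
  proof (rule LIMSEQ_I)
    fix e :: real assume e: "e > 0"
    have "\<exists>m\<in>{1..}. u m / real m < l + e / 2"
      using e unfolding l_def by (subst cINF_less_iff[symmetric, OF _ bdd]) auto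
    then obtain m where m: "m \<ge> 1" "u m / real m < l + e / 2" by auto
    \<comment> \<open>A bound for all remainder terms, which vanishes after division by
      \<open>n\<close>.\<close>
    define B where "B = (\<Sum>r<m. u r)"
    have B: "u r \<le> B" if "r < m" for r
      unfolding B_def using that nonneg by (intro member_le_sum) auto
    have upper: "u n / real n \<le> u m / real m + B / real n" if "n \<ge> 1" for n
    proof -
      have "u n \<le> real (n div m) * u m + u (n mod m)"
        using mult[of "n div m" m "n mod m"] by simp
      also have "\<dots> \<le> (real n / real m) * u m + B"
      proof (intro add_mono mult_right_mono nonneg B)
        show "real (n div m) \<le> real n / real m"
          using m by (simp add: of_nat_div_le_of_nat)
        show "n mod m < m" using m by simp
      qed
      finally show ?thesis using that m by (simp add: field_simps)
    qed
    obtain N where N: "real N > 2 * B / e" using reals_Archimedean2 by blast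
    show "\<exists>no. \<forall>n\<ge>no. norm (u n / real n - l) < e"
    proof (intro exI allI impI)
      fix n assume n: "n \<ge> Suc N"
      then have "2 * B / e < real n" using N by linarith
      then have "B / real n < e / 2" using e n by (simp add: field_simps)
      moreover have "l \<le> u n / real n" "u n / real n \<le> u m / real m + B / real n"
        using upper[of n] lower[of n] n by auto
      ultimately show "norm (u n / real n - l) < e"
        unfolding real_norm_def abs_less_iff using m(2) by linarith
    qed
  qed
  moreover have "l \<le> u 1" using lower[of 1] by simp
  ultimately show ?thesis using that \<open>0 \<le> l\<close> by blast
qed

lemma p_diamond_bounds:
  assumes "0 < p" "p < 1"
  shows "0 \<le> p_diamond p" "p_diamond p \<le> 1"
proof -
  have "p ^ 4 \<le> p\<^sup>2" using assms by (intro power_decreasing) auto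
  moreover have "0 < p\<^sup>2" "0 < p ^ 4" using assms by simp_all
  ultimately have "p ^ 4 \<le> 2 * p\<^sup>2 - p ^ 4" "0 < 2 * p\<^sup>2 - p ^ 4" by linarith+
  then show "0 \<le> p_diamond p" "p_diamond p \<le> 1"
    unfolding p_diamond_def using \<open>0 < p ^ 4\<close> by (simp_all only: divide_le_eq_1_pos divide_nonneg_pos less_imp_le)
qed

text \<open>The number of tail iterations. Its order is small enough for \<open>4 ^ scale n\<close>
  to be subexponential and large enough for \<open>(99 / 100) ^ 2 ^ scale n\<close> to be
  summable.\<close>

definition scale :: "nat \<Rightarrow> nat" where
  "scale n = nat \<lfloor>sqrt (real n)\<rfloor>"

lemma scale_bounds: "real (scale n) \<le> sqrt (real n)" "sqrt (real n) - 1 \<le> real (scale n)" "scale n \<le> n"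
proof -
  have f: "0 \<le> \<lfloor>sqrt (real n)\<rfloor>" by simp
  show *: "real (scale n) \<le> sqrt (real n)"
    unfolding scale_def of_nat_nat[OF f] by simp
  show "sqrt (real n) - 1 \<le> real (scale n)"
    unfolding scale_def of_nat_nat[OF f] by linarith
  have "sqrt (real n) \<le> real n"
  proof (cases "n = 0")
    case False
    then have "real n * 1 \<le> real n * real n" by (intro mult_left_mono) auto
    then show ?thesis by (intro real_le_lsqrt) (auto simp: power2_eq_square)
  qed simp
  with * show "scale n \<le> n" by linarith
qed

text \<open>Bounding the floor by \<open>sqrt n - 1\<close> leaves an elementary function of
  \<open>n\<close>, which decays faster than \<open>1 / n^2\<close>.\<close>

lemma summable_tail: "summable (\<lambda>n. (99 / 100 :: real) ^ 2 ^ scale n)"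
proof (rule summable_comparison_test_bigo)
  show "summable (\<lambda>n. norm (inverse (real n ^ 2)))"
    using inverse_power_summable[of 2, where 'a = real] by simp
  have le: "(99 / 100 :: real) ^ 2 ^ scale n \<le> (99 / 100) powr (2 powr (sqrt (real n) - 1))" for n
  proof -
    have "2 powr (sqrt (real n) - 1) \<le> 2 powr real (scale n)"
      using scale_bounds(2)[of n] by (intro powr_mono) auto
    then have "2 powr (sqrt (real n) - 1) \<le> real (2 ^ scale n)" by (simp add: powr_realpow)
    then have "(99 / 100 :: real) powr real (2 ^ scale n) \<le> (99 / 100) powr (2 powr (sqrt (real n) - 1))"
      by (intro powr_mono') auto
    then show ?thesis by (subst (asm) powr_realpow) auto
  qed
  have "(\<lambda>n. (99 / 100 :: real) ^ 2 ^ scale n) \<in> O(\<lambda>n. (99 / 100) powr (2 powr (sqrt (real n) - 1)))"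
    using le by (intro bigoI[of _ 1]) auto
  also have "(\<lambda>n. (99 / 100 :: real) powr (2 powr (sqrt (real n) - 1))) \<in> O(\<lambda>n. inverse (real n ^ 2))"
    by real_asymp
  finally show "(\<lambda>n. (99 / 100 :: real) ^ 2 ^ scale n) \<in> O(\<lambda>n. inverse (real n ^ 2))" .
qed

text \<open>Measurability is read off from the integrability of the indicator of \<open>A\<close>
  evaluated at the resistance.\<close>

lemma prob_resistance:
  assumes "diamond_series_process M p c" "0 < p" "p < 1"
  shows "{\<omega> \<in> space M. resistance c n \<omega> \<in> A} \<in> sets M"
    and "measure M {\<omega> \<in> space M. resistance c n \<omega> \<in> A} = measure_pmf.prob (law (p_diamond p) n) A"
proof -
  interpret diamond_series_process M p c by fact
  let ?S = "{\<omega> \<in> space M. resistance c n \<omega> \<in> A}"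
  have [measurable]: "(\<lambda>\<omega>. indicator A (resistance c n \<omega>) :: real) \<in> borel_measurable M"
    using integrable_resistance[OF assms, where h = "indicator A"] by (rule borel_measurable_integrable)
  have "{\<omega> \<in> space M. (indicator A (resistance c n \<omega>) :: real) = 1} \<in> sets M" by measurable
  also have "{\<omega> \<in> space M. (indicator A (resistance c n \<omega>) :: real) = 1} = ?S"
    by (auto simp: indicator_def)
  finally show S: "?S \<in> sets M" .
  have "measure M ?S = (\<integral>\<omega>. indicator ?S \<omega> \<partial>M)"
    using S by (simp add: Int_absorb2)
  also have "\<dots> = (\<integral>\<omega>. indicator A (resistance c n \<omega>) \<partial>M)"
    by (intro Bochner_Integration.integral_cong) (auto simp: indicator_def)
  also have "\<dots> = measure_pmf.prob (law (p_diamond p) n) A"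
    by (subst expectation_resistance[OF assms]) simp
  finally show "measure M ?S = measure_pmf.prob (law (p_diamond p) n) A" .
qed

definition threshold :: "real \<Rightarrow> nat \<Rightarrow> real" where
  "threshold q n = mean q n / (100 * 4 ^ scale n)"

lemma tail_threshold:
  assumes "0 \<le> q" "q \<le> 1"
  shows "measure_pmf.prob (law q n) {..threshold q n} \<le> (99 / 100) ^ 2 ^ scale n"
  unfolding threshold_def using assms scale_bounds(3) by (rule tail_law_mean)

lemma threshold_pos: "threshold q n > 0"
  using mean_bounds(1)[of q n] by (simp add: threshold_def)

text \<open>The logarithms of threshold and mean differ by a term of order
  \<open>sqrt n\<close>.\<close>

lemma threshold_tendsto:
  assumes "(\<lambda>n. ln (mean q n) / real n) \<longlonglongrightarrow> \<alpha>"
  shows "(\<lambda>n. ln (threshold q n) / real n) \<longlonglongrightarrow> \<alpha>"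
proof -
  have "ln (threshold q n) / real n = ln (mean q n) / real n - ln 100 / real n - ln 4 * (real (scale n) / real n)" for n
    using mean_bounds(1)[of q n]
    by (simp add: threshold_def ln_div ln_mult ln_realpow diff_divide_distrib add_divide_distrib)
  moreover have "(\<lambda>n. real (scale n) / real n) \<longlonglongrightarrow> 0"
  proof (rule tendsto_sandwich[of "\<lambda>_. 0"])
    show "\<forall>\<^sub>F n in sequentially. real (scale n) / real n \<le> sqrt (real n) / real n"
      using scale_bounds(1) by (intro always_eventually allI divide_right_mono) auto
    show "(\<lambda>n. sqrt (real n) / real n) \<longlonglongrightarrow> 0" by real_asymp
  qed auto
  moreover have "(\<lambda>n. ln 100 / real n) \<longlonglongrightarrow> 0" by real_asymp
  ultimately show ?thesis
    using tendsto_diff[OF tendsto_diff[OF assms] tendsto_mult_left[of _ 0 _ "ln 4"]] by force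
qed

text \<open>Jensen's inequality through the tangent of \<open>ln\<close> at the mean.\<close>

lemma E_ln_le: "E (law q n) ln \<le> ln (mean q n)"
proof -
  let ?m = "mean q n"
  have m: "?m > 0" using mean_bounds(1)[of q n] by linarith
  have "E (law q n) ln \<le> E (law q n) (\<lambda>x. ln ?m + (x / ?m - 1))"
  proof (rule E_mono[OF finite_law])
    fix x assume "x \<in> set_pmf (law q n)"
    then have "x > 0" by (rule law_pos)
    then show "ln x \<le> ln ?m + (x / ?m - 1)"
      using m ln_le_minus_one[of "x / ?m"] by (simp add: ln_div)
  qed
  also have "\<dots> = ln ?m"
  proof -
    have "integrable (law q n) f" for f :: "real \<Rightarrow> real"
      by (rule integrable_measure_pmf_finite[OF finite_law])
    then have "E (law q n) (\<lambda>x. ln ?m + (x / ?m - 1)) = ln ?m + (E (law q n) (\<lambda>x. x) / ?m - 1)"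
      by simp
    then show ?thesis using m by (simp add: mean_def[symmetric])
  qed
  finally show ?thesis .
qed

text \<open>On the support, \<open>ln x\<close> is at least \<open>ln ?a\<close> above the threshold
  and at least 0 below it, where \<open>ln ?a - ln ?m\<close> is nonpositive. The correction is thus
  weighted by the small tail probability.\<close>

lemma E_ln_ge:
  assumes "0 \<le> q" "q \<le> 1"
  shows "ln (threshold q n) - ln (mean q n) * (99 / 100) ^ 2 ^ scale n \<le> E (law q n) ln"
proof -
  let ?a = "threshold q n" and ?m = "mean q n" and ?P = "measure_pmf.prob (law q n) {..threshold q n}"
  have "1 \<le> 100 * (4 :: real) ^ scale n"
    using one_le_power[of "4 :: real" "scale n"] by linarith
  then have "?a \<le> ?m / 1"
    unfolding threshold_def using mean_bounds(1)[of q n] by (intro divide_left_mono) auto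
  then have a: "ln ?a \<le> ln ?m" using threshold_pos[of q n] by simp
  have m: "0 \<le> ln ?m" using mean_bounds(1)[of q n] by simp
  have "ln ?m * ?P \<le> ln ?m * (99 / 100) ^ 2 ^ scale n"
    using tail_threshold[OF assms, of n] m by (intro mult_left_mono)
  then have "ln ?a - ln ?m * (99 / 100) ^ 2 ^ scale n \<le> ln ?a - ln ?m * ?P" by simp
  also have "\<dots> = E (law q n) (\<lambda>x. ln ?a - ln ?m * indicator {..?a} x)"
    by (simp add: integrable_measure_pmf_finite[OF finite_law])
  also have "\<dots> \<le> E (law q n) ln"
  proof (rule E_mono[OF finite_law])
    fix x assume "x \<in> set_pmf (law q n)"
    then have "x \<ge> 1" using set_law[of q n] by auto
    then have "0 \<le> ln x" by simp
    moreover have "ln ?a \<le> ln x" if "?a < x" using that threshold_pos[of q n] by simp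
    ultimately show "ln ?a - ln ?m * indicator {..?a} x \<le> ln x"
      using a by (auto simp: indicator_def not_le)
  qed
  finally show ?thesis .
qed

lemma E_ln_tendsto:
  assumes "0 \<le> q" "q \<le> 1" and lim: "(\<lambda>n. ln (mean q n) / real n) \<longlonglongrightarrow> \<alpha>"
  shows "(\<lambda>n. E (law q n) ln / real n) \<longlonglongrightarrow> \<alpha>"
proof (rule tendsto_sandwich)
  show "\<forall>\<^sub>F n in sequentially. E (law q n) ln / real n \<le> ln (mean q n) / real n"
    by (intro always_eventually allI divide_right_mono E_ln_le) auto
  show "\<forall>\<^sub>F n in sequentially. ln (threshold q n) / real n - ln (mean q n) / real n * (99 / 100) ^ 2 ^ scale n
      \<le> E (law q n) ln / real n"
  proof (intro always_eventually allI)
    fix n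
    have "(ln (threshold q n) - ln (mean q n) * (99 / 100) ^ 2 ^ scale n) / real n \<le> E (law q n) ln / real n"
      using E_ln_ge[OF assms(1,2)] by (intro divide_right_mono) auto
    then show "ln (threshold q n) / real n - ln (mean q n) / real n * (99 / 100) ^ 2 ^ scale n \<le> E (law q n) ln / real n"
      by (simp add: diff_divide_distrib)
  qed
  have "(\<lambda>n. ln (threshold q n) / real n - ln (mean q n) / real n * (99 / 100) ^ 2 ^ scale n) \<longlonglongrightarrow> \<alpha> - \<alpha> * 0"
    by (intro tendsto_intros threshold_tendsto lim summable_LIMSEQ_zero summable_tail)
  then show "(\<lambda>n. ln (threshold q n) / real n - ln (mean q n) / real n * (99 / 100) ^ 2 ^ scale n) \<longlonglongrightarrow> \<alpha>"
    by simp
qed (rule lim)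

text \<open>Markov's inequality; the factor \<open>n^2\<close> makes the bound summable and is
  invisible on the exponential scale.\<close>

lemma upper_tail_law:
  assumes "n > 0"
  shows "measure_pmf.prob (law q n) {(real n)\<^sup>2 * mean q n..} \<le> inverse (real n ^ 2)"
proof -
  let ?c = "(real n)\<^sup>2 * mean q n"
  have c: "?c > 0" using assms mean_bounds(1)[of q n] by simp
  have "measure_pmf.prob (law q n) {?c..} \<le> E (law q n) (\<lambda>x. x / ?c)"
    unfolding prob_eq_E
  proof (rule E_mono[OF finite_law])
    fix x assume "x \<in> set_pmf (law q n)"
    then have "x > 0" by (rule law_pos)
    then show "indicator {?c..} x \<le> x / ?c" using c by (auto simp: indicator_def)
  qed
  also have "\<dots> = mean q n / ?c" by (simp add: mean_def)
  also have "\<dots> = inverse (real n ^ 2)" using mean_bounds(1)[of q n] by (simp add: field_simps)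
  finally show ?thesis .
qed

text \<open>By the first Borel-Cantelli lemma, almost surely the resistance eventually lies between
  the threshold and \<open>n^2\<close> times the mean, whose logarithms both grow at rate
  \<open>\<alpha>\<close>.\<close>

lemma AE_resistance_tendsto:
  assumes M: "diamond_series_process M p c" and p: "0 < p" "p < 1"
    and lim: "(\<lambda>n. ln (mean (p_diamond p) n) / real n) \<longlonglongrightarrow> \<alpha>"
  shows "AE \<omega> in M. (\<lambda>n. ln (resistance c n \<omega>) / real n) \<longlonglongrightarrow> \<alpha>"
proof -
  interpret diamond_series_process M p c by fact
  let ?q = "p_diamond p"
  note q = p_diamond_bounds[OF p]
  let ?lo = "\<lambda>n. {\<omega> \<in> space M. resistance c n \<omega> \<in> {..threshold ?q n}}"
  let ?hi = "\<lambda>n. {\<omega> \<in> space M. resistance c n \<omega> \<in> {(real n)\<^sup>2 * mean ?q n..}}"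
  have lo: "AE \<omega> in M. \<forall>\<^sub>F n in sequentially. \<omega> \<in> space M - ?lo n"
  proof (rule borel_cantelli_AE1)
    show "summable (\<lambda>n. measure M (?lo n))"
      by (rule summable_comparison_test[OF _ summable_tail])
        (use tail_threshold[OF q] in \<open>auto simp only: prob_resistance(2)[OF M p] real_norm_def abs_of_nonneg measure_nonneg\<close>)
  qed (rule prob_resistance(1)[OF M p], simp add: less_top[symmetric])
  have hi: "AE \<omega> in M. \<forall>\<^sub>F n in sequentially. \<omega> \<in> space M - ?hi n"
  proof (rule borel_cantelli_AE1)
    have "norm (measure M (?hi n)) \<le> inverse (real n ^ 2)" if "n \<ge> 1" for n
      using upper_tail_law[of n ?q] that by (simp only: prob_resistance(2)[OF M p] real_norm_def abs_of_nonneg measure_nonneg)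
    then show "summable (\<lambda>n. measure M (?hi n))"
      by (intro summable_comparison_test[OF _ inverse_power_summable[of 2, where 'a = real]]) auto
  qed (rule prob_resistance(1)[OF M p], simp add: less_top[symmetric])
  from lo hi show ?thesis
  proof eventually_elim
    case (elim \<omega>)
    have bounds: "\<forall>\<^sub>F n in sequentially. ln (threshold ?q n) / real n \<le> ln (resistance c n \<omega>) / real n \<and>
        ln (resistance c n \<omega>) / real n \<le> 2 * (ln (real n) / real n) + ln (mean ?q n) / real n"
      using elim eventually_gt_at_top[of 0]
    proof eventually_elim
      case (elim n)
      let ?R = "resistance c n \<omega>"
      have m: "mean ?q n > 0" using mean_bounds(1)[of ?q n] by linarith
      have R: "threshold ?q n < ?R" "?R < (real n)\<^sup>2 * mean ?q n" "?R > 0"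
        using elim threshold_pos[of ?q n] by auto
      have "ln ?R \<le> ln ((real n)\<^sup>2 * mean ?q n)" using R by simp
      also have "\<dots> = 2 * ln (real n) + ln (mean ?q n)"
      proof -
        have "real n > 0" using elim by simp
        then have "ln ((real n)\<^sup>2 * mean ?q n) = ln ((real n)\<^sup>2) + ln (mean ?q n)"
          using m by (simp add: ln_mult)
        then show ?thesis using \<open>real n > 0\<close> by (simp add: ln_realpow)
      qed
      finally have "ln ?R / real n \<le> (2 * ln (real n) + ln (mean ?q n)) / real n"
        by (intro divide_right_mono) auto
      moreover have "ln (threshold ?q n) \<le> ln ?R" using R threshold_pos[of ?q n] by simp
      then have "ln (threshold ?q n) / real n \<le> ln ?R / real n" by (intro divide_right_mono) auto
      ultimately show ?case by (simp add: add_divide_distrib)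
    qed
    have up: "(\<lambda>n. ln (real n) / real n) \<longlonglongrightarrow> 0" by real_asymp
    have "(\<lambda>n. 2 * (ln (real n) / real n) + ln (mean ?q n) / real n) \<longlonglongrightarrow> 2 * 0 + \<alpha>"
      by (intro tendsto_add tendsto_mult_left up lim)
    then have up': "(\<lambda>n. 2 * (ln (real n) / real n) + ln (mean ?q n) / real n) \<longlonglongrightarrow> \<alpha>" by simp
    show ?case
    proof (rule tendsto_sandwich[OF _ _ threshold_tendsto[OF lim] up'])
      show "\<forall>\<^sub>F n in sequentially. ln (threshold ?q n) / real n \<le> ln (resistance c n \<omega>) / real n"
        using bounds by (rule eventually_mono) simp
      show "\<forall>\<^sub>F n in sequentially. ln (resistance c n \<omega>) / real n \<le> 2 * (ln (real n) / real n) + ln (mean ?q n) / real n"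
        using bounds by (rule eventually_mono) simp
    qed
  qed
qed

theorem theorem4p6:
  fixes p :: real
  assumes "0 < p" and "p < 1"
  shows "\<exists>\<alpha>\<in>{0..ln 2}. \<forall>(M :: 'w measure) c. diamond_series_process M p c \<longrightarrow>
           (AE \<omega> in M. (\<lambda>n. 1 / real n * ln (resistance c n \<omega>)) \<longlonglongrightarrow> \<alpha>) \<and>
           (\<lambda>n. 1 / real n * (\<integral>\<omega>. ln (resistance c n \<omega>) \<partial>M)) \<longlonglongrightarrow> \<alpha> \<and>
           (\<lambda>n. 1 / real n * ln (\<integral>\<omega>. resistance c n \<omega> \<partial>M)) \<longlonglongrightarrow> \<alpha>"
proof -
  let ?q = "p_diamond p"
  note q = p_diamond_bounds[OF assms]
  have sub: "ln (mean ?q (m + n)) \<le> ln (mean ?q m) + ln (mean ?q n)" for m n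
  proof -
    have pos: "mean ?q k > 0" for k using mean_bounds(1)[of ?q k] by linarith
    have "ln (mean ?q (m + n)) \<le> ln (mean ?q m * mean ?q n)"
      using mean_submult[OF q, of m n] pos[of "m + n"] pos by (subst ln_le_cancel_iff) auto
    also have "\<dots> = ln (mean ?q m) + ln (mean ?q n)" using pos[of m] pos[of n] by (simp add: ln_mult)
    finally show ?thesis .
  qed
  \<comment> \<open>The means depend on \<open>p\<close> alone, so the constant is fixed before the
    probability space and the choices.\<close>
  obtain \<alpha> where \<alpha>: "0 \<le> \<alpha>" "\<alpha> \<le> ln (mean ?q 1)"
    and lim: "(\<lambda>n. ln (mean ?q n) / real n) \<longlonglongrightarrow> \<alpha>"
    using fekete_nonneg[OF sub] mean_bounds(1)[of ?q] by (metis ln_ge_zero)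
  have "ln (mean ?q 1) \<le> ln 2" using mean_bounds[of ?q 1] by simp
  with \<alpha> have "\<alpha> \<in> {0..ln 2}" by simp
  moreover have "(AE \<omega> in M. (\<lambda>n. 1 / real n * ln (resistance c n \<omega>)) \<longlonglongrightarrow> \<alpha>) \<and>
      (\<lambda>n. 1 / real n * (\<integral>\<omega>. ln (resistance c n \<omega>) \<partial>M)) \<longlonglongrightarrow> \<alpha> \<and>
      (\<lambda>n. 1 / real n * ln (\<integral>\<omega>. resistance c n \<omega> \<partial>M)) \<longlonglongrightarrow> \<alpha>"
    if M: "diamond_series_process M p c" for M :: "'w measure" and c
    using AE_resistance_tendsto[OF M assms lim] E_ln_tendsto[OF q lim] lim
      expectation_resistance[OF M assms, where h = "\<lambda>x. x"] expectation_resistance[OF M assms, where h = ln]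
    by (simp add: mean_def)
  ultimately show ?thesis by blast
qed

end
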